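(* Let $L>0$, $\alpha\in(0,1)$, $\beta=\alpha/(1-\alpha)$, $\rho>0$. Suppose that the following conditions hold. (1) The numbers $\beta_1,\rho_1,\rho_2,\beta_2$ satisfy $0<\beta_1<\tfrac12$, $0<\rho_1<\min\{1,\beta,\tfrac{2\beta_1}{1-\alpha}\}$, $\alpha\rho<\rho_2$, $\beta_2\ge0$ and $1-2\beta_2-\rho_2>0$. (2) There is a positive random variable $\chi_0$ such that: (i) with probability one, $\mathbb Y(\theta)=\mathbb Y(\theta)-\mathbb Y(\theta^* )\le-\chi_0|\theta-\theta^*|^\rho$ for all $\theta\in\Theta$; (ii) $\sup_{r\in\mathbb N}r^LP_{\mathcal C}[\chi_0\le r^{-(\rho_2-\alpha\rho)}]<\infty$ a.s. (3) $\sup_{r\in\mathbb N}r^LP_{\mathcal C}[\lambda_{min}(\Gamma)<4r^{-\rho_1}]<\infty$ a.s. (4) For every $\mathcal T\in\mathfrak T$, with $M_1=L(1-\rho_1)^{-1}$ and $M_2=L(1-2\beta_2-\rho_2)^{-1}$, $$\sup_{T\in\mathcal T}E_{\mathcal C}\big[|\Delta_T|^{M_1}\big]\Psi_T<\infty\ \text{ a.s.},\qquad \sup_{T\in\mathcal T}E_{\mathcal C}\Big[\Big(\sup_{\theta\in\Theta}b_T^{\frac12-\beta_2}|\mathbb Y_T(\theta)-\mathbb Y(\theta)|\Big)^{M_2}\Big]\Psi_T<\infty\ \text{ a.s.}$$ (5) For every $\mathcal T\in\mathfrak T$, with $M_3=L(\beta-\rho_1)^{-1}$ and $M_4=L\big(2\beta_1(1-\alpha)^{-1}-\rho_1\big)^{-1}$,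 $$\sup_{T\in\mathcal T}E_{\mathcal C}\Big[\Big(b_T^{-1}\sup_{\theta\in\Theta}|\partial_\theta^3\mathbb H_T(\theta)|\Big)^{M_3}\Big]\Psi_T<\infty\ \text{ a.s.},\qquad \sup_{T\in\mathcal T}E_{\mathcal C}\Big[\big(b_T^{\beta_1}|\Gamma_T-\Gamma|\big)^{M_4}\Big]\Psi_T<\infty\ \text{ a.s.}$$ Then for every $\mathcal T\in\mathfrak T$, $$\sup_{T\in\mathcal T}\sup_{r\in\mathbb N}r^LP_{\mathcal C}\Big[\sup_{u\in\mathbb V_T(r)}\mathbb Z_T(u)\ge\exp\big(-2^{-1}r^{2-(\rho_1\vee\rho_2)}\big)\Big]\Psi_T<\infty\quad\text{a.s.}$$ Moreover (with $\Psi_T\to^P1$ as $T\to\infty$), $\mathbb Z_T$ has the locally asymptotically quadratic representation $$\mathbb Z_T(u)=\exp\Big(\Delta_T[u]-\tfrac12\Gamma[u^{\otimes2}]+r_T(u)\Big)$$ with $r_T(u)\to^P0$ as $T\to\infty$ for every $u\in\mathbb R^{\mathsf p}$.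
   Context: $(\Omega,\mathcal F,P)$ is a probability space, $\mathcal C\subset\mathcal F$ a sub-$\sigma$-field, $P_{\mathcal C}$, $E_{\mathcal C}$ conditional probability and expectation given $\mathcal C$. $\mathbb T\subset[0,\infty)$ with $\sup\mathbb T=\infty$; $\Theta$ is a bounded domain in $\mathbb R^{\mathsf p}$ with closure $\overline\Theta$; $\theta^*\in\Theta$. For $T\in\mathbb T$, $\mathbb H_T:\Omega\times\overline\Theta\to\mathbb R$ is a jointly measurable random field, continuous in $\theta\in\overline\Theta$ and of class $C^3$ in $\theta\in\Theta$. The matrices $a_T\in GL(\mathbb R^{\mathsf p})$ satisfy $a_T\to0$ as $T\to\infty$; $\lambda_{min}$, $\lambda_{max}$ denote minimum and maximum eigenvalues of a symmetric matrix, $b_T=(\lambda_{min}(a_T^\star a_T))^{-1}$ ($^\star$ is transpose), and $b_T^{-1}\le\lambda_{max}(a_T^\star a_T)\le C_1b_T^{-1}$ for some constant $C_1\in[1,\infty)$. $\Psi_T$ ($T\in\mathbb T$) are $[0,1]$-valued $\mathcal C$-measurable random variables. $T_0>0$ is fixed and $\mathfrak T$ is the set of sequences $(T_n)_{n\in\mathbb N}$ in $\mathbb T$ with $T_n\ge T_0$ for all $n$ and $T_n\to\infty$. $\theta_T^\dagger(u)=\theta^*+a_Tu$, $\mathbb U_T=\{u\in\mathbb R^{\mathsf p}:\theta_T^\dagger(u)\in\Theta\}$, $\mathbb V_T(r)=\{u\in\mathbb U_T:|u|\ge r\}$, and $\mathbb Z_T(u)=\exp(\mathbb H_T(\theta_T^\dagger(u))-\mathbb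 H_T(\theta^* ))$ for $u\in\mathbb U_T$ (a supremum of $\mathbb Z_T$ over the empty set is $0$). For fixed $u$ one has $u\in\mathbb U_T$ for all large $T$, which is where the representation of $\mathbb Z_T(u)$ is meant. $\mathbb Y:\Omega\times\Theta\to\mathbb R$ is a random field (measurable map), $\Gamma$ is a $\mathsf p\times\mathsf p$ positive definite random matrix, $\mathbb Y_T(\theta)=b_T^{-1}(\mathbb H_T(\theta)-\mathbb H_T(\theta^* ))$, and $\Delta_T$, $\Gamma_T$ are the $\mathsf p$-dimensional random vector and $\mathsf p\times\mathsf p$ random matrix given by $\Delta_T[u]=\partial_\theta\mathbb H_T(\theta^* )[a_Tu]$ and $\Gamma_T[u^{\otimes2}]=-\partial_\theta^2\mathbb H_T(\theta^* )[(a_Tu)^{\otimes2}]$ for $u\in\mathbb R^{\mathsf p}$. Brackets denote evaluation of (multi)linear forms, e.g. $\Gamma[u^{\otimes2}]=u^\star\Gamma u$. *)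

theory Defs
  imports "HOL-Probability.Probability"
begin

definition eigenvals :: "real^'n^'n \<Rightarrow> real set" where
  "eigenvals A = {l. \<exists>v. v \<noteq> 0 \<and> A *v v = l *\<^sub>R v}"

definition lambda_min :: "real^'n^'n \<Rightarrow> real" where
  "lambda_min A = Min (eigenvals A)"

definition lambda_max :: "real^'n^'n \<Rightarrow> real" where
  "lambda_max A = Max (eigenvals A)"

definition pos_definite :: "real^'n^'n \<Rightarrow> bool" where
  "pos_definite A \<longleftrightarrow> transpose A = A \<and> (\<forall>v. v \<noteq> 0 \<longrightarrow> 0 < v \<bullet> (A *v v))"

definition partial :: "'n \<Rightarrow> (real^'n \<Rightarrow> real) \<Rightarrow> real^'n \<Rightarrow> real" where
  "partial i f x = frechet_derivative f (at x) (axis i 1)"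

text \<open>Class \<open>C\<^sup>k\<close> on an open set \<open>S\<close>.\<close>
primrec Ck_on :: "nat \<Rightarrow> (real^'n) set \<Rightarrow> (real^'n \<Rightarrow> real) \<Rightarrow> bool" where
  "Ck_on 0 S f \<longleftrightarrow> continuous_on S f"
| "Ck_on (Suc k) S f \<longleftrightarrow>
     (\<forall>x\<in>S. f differentiable (at x)) \<and> (\<forall>i. Ck_on k S (partial i f))"

text \<open>The norms that the type \<open>vec\<close> puts on these derivative arrays are the
  Euclidean norms of the arrays of entries.\<close>
definition D1 :: "(real^'n \<Rightarrow> real) \<Rightarrow> real^'n \<Rightarrow> real^'n" where
  "D1 f x = (\<chi> i. partial i f x)"

definition D2 :: "(real^'n \<Rightarrow> real) \<Rightarrow> real^'n \<Rightarrow> real^'n^'n" where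
  "D2 f x = (\<chi> i j. partial j (partial i f) x)"

definition D3 :: "(real^'n \<Rightarrow> real) \<Rightarrow> real^'n \<Rightarrow> real^'n^'n^'n" where
  "D3 f x = (\<chi> i j k. partial k (partial j (partial i f)) x)"

text \<open>\<open>P\<^sub>\<C>[A]\<close>, as an extended nonnegative random variable. The library sets \<open>nn_cond_exp\<close>
  to 0 on functions that are not measurable, so this is meaningful for measurable events only.\<close>
definition cprob :: "'a measure \<Rightarrow> 'a measure \<Rightarrow> ('a \<Rightarrow> bool) \<Rightarrow> 'a \<Rightarrow> ennreal" where
  "cprob M C A = nn_cond_exp M C (indicator {\<omega> \<in> space M. A \<omega>})"

text \<open>The smallest measurable majorant, unique up to null sets. A supremum over an uncountable
  set of a jointly measurable but discontinuous field is measurable in general only with respect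
  to the completed \<open>\<sigma>\<close>-field; its conditional expectation is that of this majorant.\<close>
definition is_meas_cover :: "'a measure \<Rightarrow> ('a \<Rightarrow> ennreal) \<Rightarrow> ('a \<Rightarrow> ennreal) \<Rightarrow> bool" where
  "is_meas_cover M f g \<longleftrightarrow> g \<in> borel_measurable M \<and> (\<forall>\<omega>\<in>space M. f \<omega> \<le> g \<omega>) \<and>
     (\<forall>h\<in>borel_measurable M. (\<forall>\<omega>\<in>space M. f \<omega> \<le> h \<omega>) \<longrightarrow> (AE \<omega> in M. g \<omega> \<le> h \<omega>))"

definition meas_cover :: "'a measure \<Rightarrow> ('a \<Rightarrow> ennreal) \<Rightarrow> 'a \<Rightarrow> ennreal" where
  "meas_cover M f = (SOME g. is_meas_cover M f g)"

lemma is_meas_cover_exists: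
  fixes f :: "'a \<Rightarrow> ennreal"
  assumes "finite_measure M"
  shows "\<exists>g. is_meas_cover M f g"
proof -
  interpret finite_measure M by fact
  define A where "A = {h \<in> borel_measurable M. \<forall>\<omega>\<in>space M. f \<omega> \<le> h \<omega>}"
  define I where "I h = (\<integral>\<^sup>+\<omega>. inverse (1 + h \<omega>) \<partial>M)" for h :: "'a \<Rightarrow> ennreal"
  have inv_anti: "inverse y \<le> inverse x" if "x \<le> y" for x y :: ennreal
  proof (cases "x = 0 \<or> y = top")
    case False
    then have "0 < enn2real x" "x < top" "y < top" "0 < enn2real y"
      using that by (auto simp: less_top enn2real_positive_iff top_unique zero_less_iff_neq_zero
          intro: le_less_trans)
    then show ?thesis
      using that by (metis ennreal_enn2real enn2real_mono inverse_ennreal ennreal_leI le_imp_inverse_le)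
  qed auto
  have inv_inv: "inverse (inverse x) = x" for x :: ennreal
  proof (cases "x = 0 \<or> x = top")
    case False
    then have "0 < enn2real x" "x < top"
      by (auto simp: less_top[symmetric] enn2real_positive_iff zero_less_iff_neq_zero)
    then show ?thesis
      by (metis ennreal_enn2real inverse_ennreal inverse_inverse_eq positive_imp_inverse_positive)
  qed auto
  have inv_le: "inverse (1 + x) \<le> (1::ennreal)" for x :: ennreal
    using inv_anti[of 1 "1 + x"] by simp
  have top: "(\<lambda>_. top) \<in> A"
    by (simp add: A_def)
  then have "I ` A \<noteq> {}" by auto
  then obtain u where u: "incseq u" "range u \<subseteq> I ` A" "Sup (I ` A) = (SUP n. u n)"
    using ennreal_Sup_countable_SUP by metis
  then have "\<forall>n. \<exists>h\<in>A. u n = I h" by auto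
  then obtain h where h: "\<And>n. h n \<in> A" "\<And>n. u n = I (h n)" by metis
  define g where "g \<omega> = (INF n. h n \<omega>)" for \<omega>
  have [measurable]: "h n \<in> borel_measurable M" for n using h(1)[of n] by (simp add: A_def)
  have g_meas [measurable]: "g \<in> borel_measurable M" unfolding g_def by measurable
  have fg: "f \<omega> \<le> g \<omega>" if "\<omega> \<in> space M" for \<omega>
    unfolding g_def using h(1) that by (auto simp: A_def intro!: INF_greatest)
  have anti: "I k \<le> I k'" if "\<And>\<omega>. k' \<omega> \<le> k \<omega>" for k k'
    unfolding I_def by (intro nn_integral_mono inv_anti add_left_mono that)
  have "u n \<le> I g" for n
    unfolding h(2) by (rule anti) (auto simp: g_def intro: INF_lower)
  then have gmax: "I k \<le> I g" if "k \<in> A" for k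
    using that u(3) by (metis SUP_le_iff SUP_upper UNIV_I order_trans)
  have fin: "I g < \<infinity>"
  proof -
    have "I g \<le> (\<integral>\<^sup>+\<omega>. 1 \<partial>M)" unfolding I_def by (intro nn_integral_mono inv_le)
    then show ?thesis using emeasure_finite[of "space M"] by (auto simp: less_top[symmetric] top_unique)
  qed
  have "AE \<omega> in M. g \<omega> \<le> k \<omega>" if k: "k \<in> borel_measurable M" "\<forall>\<omega>\<in>space M. f \<omega> \<le> k \<omega>" for k
  proof -
    note [measurable] = k(1)
    define m where "m \<omega> = min (g \<omega>) (k \<omega>)" for \<omega>
    have [measurable]: "m \<in> borel_measurable M" unfolding m_def by measurable
    have "m \<in> A" using fg k by (auto simp: A_def m_def)
    then have le: "I m \<le> I g" by (rule gmax)
    have pt: "inverse (1 + g \<omega>) \<le> inverse (1 + m \<omega>)" for \<omega>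
      by (intro inv_anti add_left_mono) (simp add: m_def)
    have "(\<integral>\<^sup>+\<omega>. inverse (1 + m \<omega>) - inverse (1 + g \<omega>) \<partial>M) = I m - I g"
      unfolding I_def using fin pt by (intro nn_integral_diff) (auto simp: I_def)
    also have "\<dots> = 0" using le le_less_trans[OF le fin] by (simp add: diff_eq_0_iff_ennreal)
    finally have "AE \<omega> in M. inverse (1 + m \<omega>) - inverse (1 + g \<omega>) = 0"
      by (subst (asm) nn_integral_0_iff_AE) auto
    then show ?thesis
    proof eventually_elim
      case (elim \<omega>)
      have "inverse (1 + g \<omega>) \<noteq> top" using inv_le[of "g \<omega>"] by (auto simp: top_unique)
      then have "inverse (1 + m \<omega>) \<le> inverse (1 + g \<omega>)"
        using elim by (simp add: ennreal_minus_eq_0)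
      then have "inverse (1 + m \<omega>) = inverse (1 + g \<omega>)" using pt by (rule antisym)
      then have "1 + m \<omega> = 1 + g \<omega>" by (metis inv_inv)
      then have "m \<omega> = g \<omega>" by (simp add: ennreal_add_left_cancel)
      then show ?case by (metis m_def min.cobounded2)
    qed
  qed
  then show ?thesis using fg g_meas unfolding is_meas_cover_def by blast
qed

lemma meas_cover:
  assumes "finite_measure M"
  shows "is_meas_cover M f (meas_cover M f)"
  unfolding meas_cover_def using is_meas_cover_exists[OF assms] by (rule someI_ex)

lemma nn_cond_exp_meas_cover:
  assumes M: "prob_space M" "subalgebra M C" and f: "f \<in> borel_measurable M"
  shows "AE \<omega> in M. nn_cond_exp M C (meas_cover M f) \<omega> = nn_cond_exp M C f \<omega>"
proof -
  interpret prob_space M by fact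
  interpret finite_measure_subalgebra M C by standard fact
  note c = meas_cover[OF finite_measure_axioms, of f, unfolded is_meas_cover_def]
  have "AE \<omega> in M. meas_cover M f \<omega> \<le> f \<omega>" using c f by blast
  moreover have "AE \<omega> in M. f \<omega> \<le> meas_cover M f \<omega>" using c by (intro AE_I2) blast
  ultimately have "AE \<omega> in M. meas_cover M f \<omega> = f \<omega>" by eventually_elim auto
  then show ?thesis using c f by (intro nn_cond_exp_cong) auto
qed

definition enn_powr :: "ennreal \<Rightarrow> real \<Rightarrow> ennreal" where
  "enn_powr x p = (if x = \<infinity> then \<infinity> else ennreal (enn2real x powr p))"

definition conv_in_prob :: "'a measure \<Rightarrow> ('i \<Rightarrow> 'a \<Rightarrow> real) \<Rightarrow> real \<Rightarrow> 'i filter \<Rightarrow> bool" where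
  "conv_in_prob M X c F \<longleftrightarrow>
     (\<forall>\<epsilon>>0. ((\<lambda>t. measure M {\<omega> \<in> space M. \<epsilon> < \<bar>X t \<omega> - c\<bar>}) \<longlongrightarrow> 0) F)"

definition to_infty :: "real set \<Rightarrow> real filter" where
  "to_infty TT = inf at_top (principal TT)"

definition index_seqs :: "real set \<Rightarrow> real \<Rightarrow> (nat \<Rightarrow> real) set" where
  "index_seqs TT T0 = {\<tau>. (\<forall>n. \<tau> n \<in> TT \<and> T0 \<le> \<tau> n) \<and> filterlim \<tau> at_top sequentially}"

definition brate :: "(real \<Rightarrow> real^'n^'n) \<Rightarrow> real \<Rightarrow> real" where
  "brate a T = inverse (lambda_min (transpose (a T) ** a T))"

definition theta_dag :: "(real \<Rightarrow> real^'n^'n) \<Rightarrow> real^'n \<Rightarrow> real \<Rightarrow> real^'n \<Rightarrow> real^'n" where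
  "theta_dag a \<theta>s T u = \<theta>s + a T *v u"

definition UU :: "(real^'n) set \<Rightarrow> (real \<Rightarrow> real^'n^'n) \<Rightarrow> real^'n \<Rightarrow> real \<Rightarrow> (real^'n) set" where
  "UU \<Theta> a \<theta>s T = {u. theta_dag a \<theta>s T u \<in> \<Theta>}"

definition VV :: "(real^'n) set \<Rightarrow> (real \<Rightarrow> real^'n^'n) \<Rightarrow> real^'n \<Rightarrow> real \<Rightarrow> real \<Rightarrow> (real^'n) set" where
  "VV \<Theta> a \<theta>s T r = {u \<in> UU \<Theta> a \<theta>s T. r \<le> norm u}"

definition ZZ :: "(real \<Rightarrow> 'a \<Rightarrow> real^'n \<Rightarrow> real) \<Rightarrow> (real \<Rightarrow> real^'n^'n) \<Rightarrow> real^'n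
    \<Rightarrow> real \<Rightarrow> 'a \<Rightarrow> real^'n \<Rightarrow> real" where
  "ZZ H a \<theta>s T \<omega> u = exp (H T \<omega> (theta_dag a \<theta>s T u) - H T \<omega> \<theta>s)"

definition YT :: "(real \<Rightarrow> 'a \<Rightarrow> real^'n \<Rightarrow> real) \<Rightarrow> (real \<Rightarrow> real^'n^'n) \<Rightarrow> real^'n
    \<Rightarrow> real \<Rightarrow> 'a \<Rightarrow> real^'n \<Rightarrow> real" where
  "YT H a \<theta>s T \<omega> \<theta> = inverse (brate a T) * (H T \<omega> \<theta> - H T \<omega> \<theta>s)"

definition DeltaT :: "(real \<Rightarrow> 'a \<Rightarrow> real^'n \<Rightarrow> real) \<Rightarrow> (real \<Rightarrow> real^'n^'n) \<Rightarrow> real^'n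
    \<Rightarrow> real \<Rightarrow> 'a \<Rightarrow> real^'n" where
  "DeltaT H a \<theta>s T \<omega> = transpose (a T) *v D1 (H T \<omega>) \<theta>s"

definition GammaT :: "(real \<Rightarrow> 'a \<Rightarrow> real^'n \<Rightarrow> real) \<Rightarrow> (real \<Rightarrow> real^'n^'n) \<Rightarrow> real^'n
    \<Rightarrow> real \<Rightarrow> 'a \<Rightarrow> real^'n^'n" where
  "GammaT H a \<theta>s T \<omega> = - (transpose (a T) ** D2 (H T \<omega>) \<theta>s ** a T)"

lemma DeltaT_form: "DeltaT H a \<theta>s T \<omega> \<bullet> u = D1 (H T \<omega>) \<theta>s \<bullet> (a T *v u)"
  by (simp add: DeltaT_def dot_lmul_matrix flip: vector_transpose_matrix)

lemma GammaT_form: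
  fixes H :: "real \<Rightarrow> 'a \<Rightarrow> real^'n \<Rightarrow> real" and u :: "real^'n"
  shows
  "u \<bullet> (GammaT H a \<theta>s T \<omega> *v u) = - ((a T *v u) \<bullet> (D2 (H T \<omega>) \<theta>s *v (a T *v u)))"
proof -
  have neg: "(- X) *v u = - (X *v u)" for X :: "real^'n^'n"
    by (simp add: matrix_vector_mult_def vec_eq_iff sum_negf)
  have "u \<bullet> (transpose (a T) *v w) = (a T *v u) \<bullet> w" for w
    by (metis dot_lmul_matrix transpose_transpose vector_transpose_matrix)
  then show ?thesis
    by (simp add: GammaT_def neg flip: matrix_vector_mul_assoc del: transpose_matrix_vector)
qed

end

theory Submission
  imports Defs
begin

text \<open>
The tail estimate comes from a deterministic bound on the log likelihood ratio, valid outside a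
few exceptional events, each of conditional probability of order \<open>r\<^sup>-\<^sup>L\<close> after weighting
with \<open>\<Psi>\<^sub>T\<close>.

Let \<open>|u| \<ge> r\<close> and \<open>s = b\<^sub>T\<^sup>1\<^sup>/\<^sup>2\<close>, so that \<open>|a\<^sub>T u|\<close> is comparable to \<open>|u| / s\<close>. If
\<open>|u| \<le> s\<^sup>1\<^sup>-\<^sup>\<alpha>\<close>, then \<open>a\<^sub>T u\<close> is small and a third order Taylor expansion gives
\<open>\<Delta>\<^sub>T[u] - \<Gamma>[u,u] / 2\<close> up to an error controlled by \<open>|\<Gamma>\<^sub>T - \<Gamma>|\<close> and the third derivatives. When
\<open>\<lambda>\<^sub>m\<^sub>i\<^sub>n(\<Gamma>) \<ge> 4 r\<^sup>-\<^sup>\<rho>\<^sup>1\<close> and the three random coefficients lie below suitable powers of \<open>r\<close>,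
the quadratic form wins and the log likelihood ratio is at most \<open>- r\<^sup>2\<^sup>-\<^sup>\<rho>\<^sup>1\<close>
(\<open>quadratic_regime_estimate\<close>). If \<open>|u| > s\<^sup>1\<^sup>-\<^sup>\<alpha>\<close>, it equals \<open>b\<^sub>T Y\<^sub>T(\<theta>)\<close> at a point with
\<open>|\<theta> - \<theta>\<^sup>*| \<ge> s\<^sup>-\<^sup>\<alpha>\<close>. There \<open>Y\<close> is negative by the separation condition, and unless \<open>\<chi>0\<close> is small
or \<open>Y\<^sub>T - Y\<close> is large the ratio is at most \<open>- r\<^sup>2\<^sup>-\<^sup>\<rho>\<^sup>2\<close> (\<open>separation_regime_estimate\<close>). This
uses \<open>r \<le> D s\<close>, where \<open>D\<close> bounds the distance of parameters from \<open>\<theta>\<^sup>*\<close>: for larger \<open>r\<close> no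
admissible \<open>u\<close> exists. Both regimes are joined in \<open>log_likelihood_ratio_bound\<close>.

The exponents \<open>M1, ..., M4\<close> are such that the conditional Markov inequality at these powers of \<open>r\<close>
yields \<open>r\<^sup>-\<^sup>L\<close> (\<open>markov_enn_powr_tail\<close>). Hence the indicator of the event in question is
dominated by a finite sum of families that satisfy \<open>cond_tail_bounded\<close>, and this property
passes to the dominated indicator.

For the quadratic representation the remainder is bounded by the same Taylor estimate
(\<open>quadratic_remainder_bound\<close>) for fixed \<open>u\<close>. Its coefficients \<open>|\<Gamma>\<^sub>T - \<Gamma>|\<close> and
\<open>b\<^sub>T\<^sup>-\<^sup>3\<^sup>/\<^sup>2 sup |\<partial>\<^sup>3 H\<^sub>T|\<close> are negative powers of \<open>b\<^sub>T\<close> times variables whose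
conditional moments stay bounded after multiplication by \<open>\<Psi>\<^sub>T\<close>; as \<open>\<Psi>\<^sub>T\<close> tends to \<open>1\<close> in probability, they tend to \<open>0\<close> in probability
(\<open>tendsto_measure_of_cond_moments\<close>).

Measurability needs separate care, because \<^const>\<open>nn_cond_exp\<close> is \<open>0\<close> on nonmeasurable functions,
so a conditional moment bound carries information only for a measurable variable. It is therefore
proved that the smallest eigenvalue of \<open>\<Gamma>\<close>, the derivatives of \<open>H\<^sub>T\<close> at a point and the supremum
of the third derivatives are random variables.
\<close>

section \<open>Extremal eigenvalues of symmetric matrices\<close>

lemma dot_matrix_vector_symmetric:
  fixes A :: "real^'n^'n"
  assumes "transpose A = A"
  shows "(A *v u) \<bullet> v = u \<bullet> (A *v v)"
  by (metis assms dot_lmul_matrix inner_commute vector_transpose_matrix transpose_transpose)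

text \<open>
Eigenvectors of a symmetric matrix for distinct eigenvalues are orthogonal, so there cannot be more
eigenvalues than dimensions. Finiteness is what makes \<^const>\<open>Min\<close> and \<^const>\<open>Max\<close>
in \<^const>\<open>lambda_min\<close> and \<^const>\<open>lambda_max\<close> meaningful.
\<close>

lemma finite_eigenvals_symmetric:
  fixes A :: "real^'n^'n"
  assumes sym: "transpose A = A"
  shows "finite (eigenvals A)"
proof -
  have "\<forall>l\<in>eigenvals A. \<exists>v. v \<noteq> 0 \<and> A *v v = l *\<^sub>R v" by (auto simp: eigenvals_def)
  then obtain w where w: "\<And>l. l \<in> eigenvals A \<Longrightarrow> w l \<noteq> 0 \<and> A *v w l = l *\<^sub>R w l"
    by metis
  have orth: "w l \<bullet> w m = 0" if "l \<in> eigenvals A" "m \<in> eigenvals A" "l \<noteq> m" for l m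
  proof -
    have "l * (w l \<bullet> w m) = m * (w l \<bullet> w m)"
      using dot_matrix_vector_symmetric[OF sym, of "w l" "w m"] w[OF that(1)] w[OF that(2)] by simp
    then show ?thesis using that by simp
  qed
  have inj: "inj_on w (eigenvals A)"
    by (rule inj_onI) (metis inner_eq_zero_iff orth w)
  have "pairwise orthogonal (w ` eigenvals A)"
    unfolding pairwise_image pairwise_def orthogonal_def using orth by auto
  moreover have "0 \<notin> w ` eigenvals A" using w by force
  ultimately have "independent (w ` eigenvals A)" by (rule pairwise_orthogonal_independent)
  then have "finite (w ` eigenvals A)" by (rule independent_imp_finite)
  then show ?thesis using inj finite_imageD by blast
qed

text \<open>
Compactness gives a minimizer \<open>v\<close> of the form on the unit sphere, with minimum \<open>m\<close>. The form
of \<open>A - m I\<close> is nonnegative and vanishes at \<open>v\<close>, so its derivative at \<open>v\<close> vanishes in every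
direction, which says \<open>A v = m v\<close>.
\<close>

lemma quadratic_form_minimum_is_eigenvalue:
  fixes A :: "real^'n^'n"
  assumes sym: "transpose A = A"
  obtains v where "norm v = 1" "A *v v = (v \<bullet> (A *v v)) *\<^sub>R v"
    "\<And>u. (v \<bullet> (A *v v)) * (norm u)\<^sup>2 \<le> u \<bullet> (A *v u)"
proof -
  let ?S = "sphere (0::real^'n) 1"
  have "continuous_on ?S (\<lambda>u. u \<bullet> (A *v u))"
    by (intro continuous_intros matrix_vector_mult_linear_continuous_on)
  moreover have "compact ?S" "?S \<noteq> {}" by auto
  ultimately obtain v where v: "v \<in> ?S" "\<And>u. u \<in> ?S \<Longrightarrow> v \<bullet> (A *v v) \<le> u \<bullet> (A *v u)"
    using continuous_attains_inf[of ?S "\<lambda>u. u \<bullet> (A *v u)"] by metis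
  define m where "m = v \<bullet> (A *v v)"
  have le: "m * (norm u)\<^sup>2 \<le> u \<bullet> (A *v u)" for u
  proof (cases "u = 0")
    case False
    have "m \<le> (u /\<^sub>R norm u) \<bullet> (A *v (u /\<^sub>R norm u))"
      unfolding m_def using False by (intro v(2)) simp
    also have "\<dots> = (u \<bullet> (A *v u)) / (norm u)\<^sup>2"
      by (simp add: matrix_vector_mult_scaleR power2_eq_square field_simps)
    finally show ?thesis using False by (simp add: field_simps)
  qed simp
  have nv: "norm v = 1" using v(1) by simp
  have "A *v v - m *\<^sub>R v = 0"
  proof (rule ccontr)
    define z where "z = A *v v - m *\<^sub>R v"
    assume "A *v v - m *\<^sub>R v \<noteq> 0"
    then have z: "0 < z \<bullet> z" by (simp add: z_def)
    define q where "q = z \<bullet> (A *v z) - m * (z \<bullet> z)"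
    \<comment> \<open>The form of \<open>A - m I\<close> vanishes at \<open>v\<close> with slope \<open>2 (z \<bullet> z) > 0\<close> along \<open>z\<close>, so it would be
      negative at \<open>v + t z\<close> for a small negative \<open>t\<close>.\<close>
    have vz: "v \<bullet> (A *v z) - m * (v \<bullet> z) = z \<bullet> z"
      using dot_matrix_vector_symmetric[OF sym, of v z]
      by (simp add: z_def inner_diff_left inner_commute)
    have key: "0 \<le> 2 * t * (z \<bullet> z) + t\<^sup>2 * q" for t
    proof -
      have zv: "z \<bullet> (A *v v) = v \<bullet> (A *v z)"
        using dot_matrix_vector_symmetric[OF sym, of v z] by (simp add: inner_commute)
      have "0 \<le> (v + t *\<^sub>R z) \<bullet> (A *v (v + t *\<^sub>R z)) - m * ((v + t *\<^sub>R z) \<bullet> (v + t *\<^sub>R z))"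
        using le[of "v + t *\<^sub>R z"] by (simp add: power2_norm_eq_inner)
      also have "\<dots> = (v \<bullet> (A *v v) - m * (v \<bullet> v)) + 2 * t * (v \<bullet> (A *v z) - m * (v \<bullet> z)) + t\<^sup>2 * q"
        by (simp add: matrix_vector_right_distrib matrix_vector_mult_scaleR inner_simps q_def zv
            power2_eq_square algebra_simps inner_commute[of z v])
      also have "v \<bullet> (A *v v) - m * (v \<bullet> v) = 0"
        using nv by (simp add: m_def norm_eq_1)
      finally show ?thesis using vz by simp
    qed
    define t where "t = - (z \<bullet> z) / (\<bar>q\<bar> + 1)"
    have t: "t * (\<bar>q\<bar> + 1) = - (z \<bullet> z)" unfolding t_def by simp
    have "t < 0" unfolding t_def using z by (simp add: divide_neg_pos)
    have "0 \<le> t * (2 * (z \<bullet> z) + t * q)" using key[of t] by (simp add: power2_eq_square algebra_simps)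
    then have "2 * (z \<bullet> z) + t * q \<le> 0" using \<open>t < 0\<close> by (simp add: zero_le_mult_iff)
    moreover have "t * \<bar>q\<bar> \<le> t * q" using \<open>t < 0\<close> by (intro mult_left_mono_neg) auto
    moreover have "t * \<bar>q\<bar> = - (z \<bullet> z) - t" using t by (simp add: algebra_simps)
    ultimately show False using z \<open>t < 0\<close> by linarith
  qed
  then show ?thesis using that[of v] nv le by (simp add: m_def)
qed

lemma lambda_min_minimum:
  fixes A :: "real^'n^'n"
  assumes sym: "transpose A = A"
  shows "\<exists>v. norm v = 1 \<and> v \<bullet> (A *v v) = lambda_min A"
    and "lambda_min A * (norm u)\<^sup>2 \<le> u \<bullet> (A *v u)"
proof -
  obtain v where v: "norm v = 1" "A *v v = (v \<bullet> (A *v v)) *\<^sub>R v"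
    "\<And>u. (v \<bullet> (A *v v)) * (norm u)\<^sup>2 \<le> u \<bullet> (A *v u)"
    using quadratic_form_minimum_is_eigenvalue[OF sym] by metis
  have "lambda_min A = v \<bullet> (A *v v)" unfolding lambda_min_def
  proof (rule Min_eqI[OF finite_eigenvals_symmetric[OF sym]])
    have "v \<noteq> 0" using v(1) by auto
    with v(2) show "v \<bullet> (A *v v) \<in> eigenvals A" unfolding eigenvals_def by blast
    fix l assume "l \<in> eigenvals A"
    then obtain w where w: "w \<noteq> 0" "A *v w = l *\<^sub>R w" by (auto simp: eigenvals_def)
    have "(v \<bullet> (A *v v)) * (norm w)\<^sup>2 \<le> l * (norm w)\<^sup>2"
      using v(3)[of w] w(2) by (simp add: power2_norm_eq_inner)
    then show "v \<bullet> (A *v v) \<le> l" using w(1) by simp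
  qed
  then show "\<exists>v. norm v = 1 \<and> v \<bullet> (A *v v) = lambda_min A"
    and "lambda_min A * (norm u)\<^sup>2 \<le> u \<bullet> (A *v u)" using v by auto
qed

lemma quadratic_form_le_lambda_max:
  fixes A :: "real^'n^'n"
  assumes sym: "transpose A = A"
  shows "u \<bullet> (A *v u) \<le> lambda_max A * (norm u)\<^sup>2"
proof -
  have neg: "(- A) *v w = - (A *v w)" for w
    by (simp add: matrix_vector_mult_def vec_eq_iff sum_negf)
  have "transpose (- A) = - A" using sym by (simp add: transpose_def vec_eq_iff)
  then obtain v where v: "norm v = 1" "(- A) *v v = (v \<bullet> ((- A) *v v)) *\<^sub>R v"
    "\<And>u. (v \<bullet> ((- A) *v v)) * (norm u)\<^sup>2 \<le> u \<bullet> ((- A) *v u)"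
    using quadratic_form_minimum_is_eigenvalue by metis
  have "A *v v = (v \<bullet> (A *v v)) *\<^sub>R v" using v(2) by (simp add: neg)
  moreover have "v \<noteq> 0" using v(1) by auto
  ultimately have "v \<bullet> (A *v v) \<in> eigenvals A" unfolding eigenvals_def by blast
  then have "v \<bullet> (A *v v) \<le> lambda_max A"
    unfolding lambda_max_def by (intro Max_ge finite_eigenvals_symmetric[OF sym])
  then have "(v \<bullet> (A *v v)) * (norm u)\<^sup>2 \<le> lambda_max A * (norm u)\<^sup>2"
    by (intro mult_right_mono) auto
  moreover have "u \<bullet> (A *v u) \<le> (v \<bullet> (A *v v)) * (norm u)\<^sup>2" using v(3)[of u] by (simp add: neg)
  ultimately show ?thesis by linarith
qed

text \<open>
The condition on \<open>v\<close> is open and linear in the entries of \<open>A\<close>; restricted to a countable dense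
set of vectors it makes \<open>lambda_min\<close> a measurable function of a random symmetric matrix.
\<close>

lemma lambda_min_less_iff:
  fixes A :: "real^'n^'n"
  assumes sym: "transpose A = A"
  shows "lambda_min A < c \<longleftrightarrow> (\<exists>v. v \<bullet> (A *v v) < c * (norm v)\<^sup>2)"
proof
  assume "lambda_min A < c"
  then show "\<exists>v. v \<bullet> (A *v v) < c * (norm v)\<^sup>2"
    using lambda_min_minimum(1)[OF sym] by (metis mult.right_neutral one_power2)
next
  assume "\<exists>v. v \<bullet> (A *v v) < c * (norm v)\<^sup>2"
  then obtain v where "v \<bullet> (A *v v) < c * (norm v)\<^sup>2" by blast
  then have "lambda_min A * (norm v)\<^sup>2 < c * (norm v)\<^sup>2"
    using lambda_min_minimum(2)[OF sym, of v] by linarith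
  then show "lambda_min A < c" by (rule mult_right_less_imp_less) simp
qed

lemma borel_measurable_matrix_vector_mult [measurable]:
  fixes G :: "'a \<Rightarrow> real^'n^'m"
  assumes "G \<in> borel_measurable M"
  shows "(\<lambda>\<omega>. G \<omega> *v u) \<in> borel_measurable M"
proof -
  have "(\<lambda>A::real^'n^'m. A *v u) \<in> borel_measurable borel"
    by (intro borel_measurable_continuous_onI linear_continuous_on
        bounded_linear_intros linear_conv_bounded_linear[THEN iffD1])
      (auto simp: linear_iff matrix_vector_mult_def vec_eq_iff sum.distrib algebra_simps sum_distrib_left)
  then show ?thesis using assms by (rule measurable_compose[rotated])
qed

lemma lambda_min_less_measurable:
  fixes G :: "'a \<Rightarrow> real^'n^'n"
  assumes [measurable]: "G \<in> borel_measurable M" and sym: "\<And>\<omega>. \<omega> \<in> space M \<Longrightarrow> transpose (G \<omega>) = G \<omega>"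
  shows "{\<omega> \<in> space M. lambda_min (G \<omega>) < c} \<in> sets M"
proof -
  obtain Q :: "(real^'n) set" where Q: "countable Q" "\<And>X. open X \<Longrightarrow> X \<noteq> {} \<Longrightarrow> \<exists>q\<in>Q. q \<in> X"
    using countable_dense_setE by metis
  have "lambda_min A < c \<longleftrightarrow> (\<exists>v\<in>Q. v \<bullet> (A *v v) < c * (norm v)\<^sup>2)" if "transpose A = A" for A :: "real^'n^'n"
  proof -
    have "open {v. v \<bullet> (A *v v) < c * (norm v)\<^sup>2}"
      by (intro open_Collect_less continuous_intros matrix_vector_mult_linear_continuous_on)
    then show ?thesis unfolding lambda_min_less_iff[OF that] using Q(2) by blast
  qed
  then have "{\<omega> \<in> space M. lambda_min (G \<omega>) < c} =
      (\<Union>v\<in>Q. {\<omega> \<in> space M. v \<bullet> (G \<omega> *v v) < c * (norm v)\<^sup>2})" using sym by auto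
  also have "\<dots> \<in> sets M" by (intro sets.countable_UN'' Q(1)) measurable
  finally show ?thesis .
qed

text \<open>
The squared norm of \<open>a\<^sub>T u\<close> is the quadratic form of \<open>a\<^sub>T\<^sup>* a\<^sub>T\<close>, whose smallest
eigenvalue is \<open>1 / b\<^sub>T\<close>. Up to the constant \<open>C1\<close>, the map \<open>u \<mapsto> a\<^sub>T u\<close> is therefore a
similarity with factor \<open>b\<^sub>T\<^sup>-\<^sup>1\<^sup>/\<^sup>2\<close>.
\<close>

lemma normalizing_matrix_bounds:
  fixes a :: "real \<Rightarrow> real^'n^'n"
  assumes inv: "invertible (a T)"
    and upper: "lambda_max (transpose (a T) ** a T) \<le> C1 * inverse (brate a T)"
  shows "0 < brate a T" and "(norm u)\<^sup>2 \<le> brate a T * (norm (a T *v u))\<^sup>2"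
    and "(norm (a T *v u))\<^sup>2 \<le> C1 / brate a T * (norm u)\<^sup>2"
proof -
  let ?A = "transpose (a T) ** a T"
  have sym: "transpose ?A = ?A" by (simp add: matrix_transpose_mul)
  have form: "u \<bullet> (?A *v u) = (norm (a T *v u))\<^sup>2" for u
    by (metis dot_lmul_matrix matrix_vector_mul_assoc power2_norm_eq_inner vector_transpose_matrix transpose_transpose)
  obtain v where v: "norm v = 1" "v \<bullet> (?A *v v) = lambda_min ?A"
    using lambda_min_minimum(1)[OF sym] by blast
  have "a T *v v \<noteq> 0"
    using inv v(1) by (metis matrix_left_invertible_ker invertible_left_inverse norm_zero zero_neq_one)
  then have pos: "0 < lambda_min ?A" using v(2) by (simp add: form flip: v(2))
  then show "0 < brate a T" by (simp add: brate_def)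
  show "(norm u)\<^sup>2 \<le> brate a T * (norm (a T *v u))\<^sup>2"
    using lambda_min_minimum(2)[OF sym, of u] pos by (simp add: form brate_def field_simps)
  have "(norm (a T *v u))\<^sup>2 \<le> lambda_max ?A * (norm u)\<^sup>2"
    using quadratic_form_le_lambda_max[OF sym, of u] by (simp add: form)
  also have "\<dots> \<le> C1 / brate a T * (norm u)\<^sup>2"
    using upper by (intro mult_right_mono) (auto simp: divide_inverse)
  finally show "(norm (a T *v u))\<^sup>2 \<le> C1 / brate a T * (norm u)\<^sup>2" .
qed

lemma borel_measurable_matrix_const_mult:
  fixes v :: "'a \<Rightarrow> real^'n" and A :: "real^'n^'m"
  assumes "v \<in> borel_measurable M"
  shows "(\<lambda>\<omega>. A *v v \<omega>) \<in> borel_measurable M"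
  using borel_measurable_continuous_onI[OF matrix_vector_mult_linear_continuous_on] assms
  by (rule measurable_compose[rotated])

lemma borel_measurable_matrix_sandwich:
  fixes G :: "'a \<Rightarrow> real^'n^'m" and A :: "real^'m^'k" and B :: "real^'p^'n"
  assumes "G \<in> borel_measurable M"
  shows "(\<lambda>\<omega>. A ** G \<omega> ** B) \<in> borel_measurable M"
proof -
  have "continuous_on UNIV (\<lambda>X. A ** X ** B)"
    unfolding matrix_matrix_mult_def by (intro continuous_intros)
  from borel_measurable_continuous_onI[OF this] assms show ?thesis
    by (rule measurable_compose[rotated])
qed

section \<open>Derivatives of random fields and Taylor expansion\<close>

lemma has_real_derivative_along_line:
  fixes f :: "real^'n \<Rightarrow> real"
  assumes "f differentiable (at (x + t *\<^sub>R h))"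
  shows "((\<lambda>s. f (x + s *\<^sub>R h)) has_real_derivative
      (\<Sum>i\<in>UNIV. h $ i * partial i f (x + t *\<^sub>R h))) (at t)"
proof -
  let ?D = "frechet_derivative f (at (x + t *\<^sub>R h))"
  have D: "(f has_derivative ?D) (at (x + t *\<^sub>R h))"
    using assms frechet_derivative_works by blast
  then have lin: "linear ?D" by (rule has_derivative_linear)
  have "?D h = ?D (\<Sum>i\<in>UNIV. h $ i *\<^sub>R axis i 1)"
    by (simp add: basis_expansion flip: scalar_mult_eq_scaleR)
  also have "\<dots> = (\<Sum>i\<in>UNIV. h $ i * partial i f (x + t *\<^sub>R h))"
    by (simp add: linear_sum[OF lin] linear_cmul[OF lin] partial_def)
  finally have Dh: "?D h = \<dots>" .
  have "((\<lambda>s. x + s *\<^sub>R h) has_derivative (\<lambda>s. s *\<^sub>R h)) (at t)"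
    by (auto intro!: derivative_eq_intros)
  then have "((\<lambda>s. f (x + s *\<^sub>R h)) has_derivative (\<lambda>s. ?D (s *\<^sub>R h))) (at t)"
    using D by (rule has_derivative_compose)
  moreover have "(\<lambda>s. ?D (s *\<^sub>R h)) = (*) (\<Sum>i\<in>UNIV. h $ i * partial i f (x + t *\<^sub>R h))"
    by (auto simp: linear_cmul[OF lin] Dh)
  ultimately show ?thesis by (simp add: has_field_derivative_def)
qed

text \<open>
At a fixed point a partial derivative is the limit of a sequence of difference quotients, each of
which uses two values of the random field only.
\<close>

lemma borel_measurable_partial:
  fixes F :: "'a \<Rightarrow> real^'n \<Rightarrow> real"
  assumes S: "open S" "x \<in> S"
    and diff: "\<And>\<omega>. \<omega> \<in> space M \<Longrightarrow> F \<omega> differentiable (at x)"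
    and meas: "\<And>y. y \<in> S \<Longrightarrow> (\<lambda>\<omega>. F \<omega> y) \<in> borel_measurable M"
  shows "(\<lambda>\<omega>. partial i (F \<omega>) x) \<in> borel_measurable M"
proof -
  obtain e where e: "e > 0" "ball x e \<subseteq> S" using S openE by blast
  define h where "h k = e / 2 * inverse (real (Suc k))" for k
  have h0: "h k > 0" for k using e by (simp add: h_def)
  have hle: "h k \<le> e / 2" for k using e by (simp add: h_def field_simps)
  have "h \<longlonglongrightarrow> e / 2 * 0" unfolding h_def by (intro tendsto_intros LIMSEQ_inverse_real_of_nat)
  then have hlim: "h \<longlonglongrightarrow> 0" by simp
  show ?thesis
  proof (rule borel_measurable_LIMSEQ_real)
    fix k
    have "dist x (x + h k *\<^sub>R axis i 1) < e" using h0[of k] hle[of k] e by (simp add: dist_norm)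
    then have "x + h k *\<^sub>R axis i 1 \<in> S" using e by auto
    then show "(\<lambda>\<omega>. (F \<omega> (x + h k *\<^sub>R axis i 1) - F \<omega> x) / h k) \<in> borel_measurable M"
      using meas S(2) by measurable
  next
    fix \<omega> assume "\<omega> \<in> space M"
    then have "F \<omega> differentiable (at (x + 0 *\<^sub>R axis i 1))" using diff by simp
    from has_real_derivative_along_line[OF this]
    have "((\<lambda>s. F \<omega> (x + s *\<^sub>R axis i 1)) has_real_derivative partial i (F \<omega>) x) (at 0)"
      by (simp add: axis_def if_distrib[of "\<lambda>z. z * _"] cong: if_cong)
    then have "((\<lambda>s. (F \<omega> (x + s *\<^sub>R axis i 1) - F \<omega> x) / s) \<longlongrightarrow> partial i (F \<omega>) x) (at 0)"
      by (simp add: DERIV_def)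
    moreover have "filterlim h (at 0) sequentially"
      using hlim h0 by (simp add: filterlim_at less_imp_neq[symmetric])
    ultimately show "(\<lambda>k. (F \<omega> (x + h k *\<^sub>R axis i 1) - F \<omega> x) / h k) \<longlonglongrightarrow> partial i (F \<omega>) x"
      by (rule filterlim_compose)
  qed
qed

lemma borel_measurable_vec_components:
  fixes F :: "'a \<Rightarrow> ('b::euclidean_space)^'n"
  assumes "\<And>i. (\<lambda>\<omega>. F \<omega> $ i) \<in> borel_measurable M"
  shows "F \<in> borel_measurable M"
proof -
  have "(\<lambda>\<omega>. F \<omega> \<bullet> axis i u) \<in> borel_measurable M" for i u
    unfolding inner_axis by (intro borel_measurable_inner assms) simp
  then show ?thesis
    unfolding borel_measurable_euclidean_space[of F] by (auto simp: Basis_vec_def)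
qed

lemma borel_measurable_derivative_arrays:
  fixes F :: "'a \<Rightarrow> real^'n \<Rightarrow> real"
  assumes S: "open S" and x: "x \<in> S"
    and C3: "\<And>\<omega>. \<omega> \<in> space M \<Longrightarrow> Ck_on 3 S (F \<omega>)"
    and meas: "\<And>y. y \<in> S \<Longrightarrow> (\<lambda>\<omega>. F \<omega> y) \<in> borel_measurable M"
  shows "(\<lambda>\<omega>. D1 (F \<omega>) x) \<in> borel_measurable M"
    and "(\<lambda>\<omega>. D2 (F \<omega>) x) \<in> borel_measurable M"
    and "(\<lambda>\<omega>. D3 (F \<omega>) x) \<in> borel_measurable M"
proof -
  have 1: "(\<lambda>\<omega>. partial i (F \<omega>) y) \<in> borel_measurable M" if "y \<in> S" for i y
    using C3 that meas by (intro borel_measurable_partial[OF S that]) (auto simp: numeral_3_eq_3)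
  have 2: "(\<lambda>\<omega>. partial j (partial i (F \<omega>)) y) \<in> borel_measurable M" if "y \<in> S" for i j y
    using C3 that 1 by (intro borel_measurable_partial[OF S that]) (auto simp: numeral_3_eq_3)
  have 3: "(\<lambda>\<omega>. partial k (partial j (partial i (F \<omega>))) y) \<in> borel_measurable M" if "y \<in> S" for i j k y
    using C3 that 2 by (intro borel_measurable_partial[OF S that]) (auto simp: numeral_3_eq_3)
  show "(\<lambda>\<omega>. D1 (F \<omega>) x) \<in> borel_measurable M"
    "(\<lambda>\<omega>. D2 (F \<omega>) x) \<in> borel_measurable M"
    "(\<lambda>\<omega>. D3 (F \<omega>) x) \<in> borel_measurable M"
    using 1[OF x] 2[OF x] 3[OF x]
    by (auto simp: D1_def D2_def D3_def intro!: borel_measurable_vec_components)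
qed

text \<open>
By continuity the supremum over an uncountable set equals the one over a countable dense subset.
\<close>

lemma borel_measurable_SUP_continuous:
  fixes g :: "'a \<Rightarrow> 'b::{metric_space, second_countable_topology} \<Rightarrow> ennreal"
  assumes cont: "\<And>\<omega>. \<omega> \<in> space M \<Longrightarrow> continuous_on S (g \<omega>)"
    and meas: "\<And>x. x \<in> S \<Longrightarrow> (\<lambda>\<omega>. g \<omega> x) \<in> borel_measurable M"
  shows "(\<lambda>\<omega>. SUP x\<in>S. g \<omega> x) \<in> borel_measurable M"
proof -
  obtain Q where Q: "countable Q" "Q \<subseteq> S" "S \<subseteq> closure Q" using separable by metis
  have "(SUP x\<in>S. g \<omega> x) = (SUP x\<in>Q. g \<omega> x)" if "\<omega> \<in> space M" for \<omega>
  proof (rule antisym)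
    show "(SUP x\<in>S. g \<omega> x) \<le> (SUP x\<in>Q. g \<omega> x)"
    proof (rule SUP_least)
      fix x assume x: "x \<in> S"
      then obtain q where q: "\<And>k::nat. q k \<in> Q" "q \<longlonglongrightarrow> x"
        using Q(3) closure_sequential by blast
      then have "(\<lambda>k. g \<omega> (q k)) \<longlonglongrightarrow> g \<omega> x"
        using cont[OF that] x Q(2) unfolding continuous_on_sequentially comp_def by blast
      then show "g \<omega> x \<le> (SUP x\<in>Q. g \<omega> x)"
        by (rule LIMSEQ_le_const2) (auto intro!: SUP_upper q(1))
    qed
  qed (rule SUP_subset_mono[OF Q(2) order_refl])
  moreover have "(\<lambda>\<omega>. SUP x\<in>Q. g \<omega> x) \<in> borel_measurable M"
    using Q(1,2) meas by (intro borel_measurable_SUP) auto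
  ultimately show ?thesis by (simp cong: measurable_cong)
qed

lemma borel_measurable_SUP_norm_D3:
  fixes F :: "'a \<Rightarrow> real^'n \<Rightarrow> real"
  assumes S: "open S"
    and C3: "\<And>\<omega>. \<omega> \<in> space M \<Longrightarrow> Ck_on 3 S (F \<omega>)"
    and meas: "\<And>y. y \<in> S \<Longrightarrow> (\<lambda>\<omega>. F \<omega> y) \<in> borel_measurable M"
  shows "(\<lambda>\<omega>. SUP x\<in>S. ennreal (norm (D3 (F \<omega>) x))) \<in> borel_measurable M"
proof (rule borel_measurable_SUP_continuous)
  fix \<omega> assume "\<omega> \<in> space M"
  then have "continuous_on S (partial k (partial j (partial i (F \<omega>))))" for i j k
    using C3 by (auto simp: numeral_3_eq_3)
  then show "continuous_on S (\<lambda>x. ennreal (norm (D3 (F \<omega>) x)))"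
    unfolding D3_def by (intro continuous_on_ennreal continuous_intros)
next
  fix x assume "x \<in> S"
  from borel_measurable_derivative_arrays(3)[where F=F, OF S this C3 meas]
  show "(\<lambda>\<omega>. ennreal (norm (D3 (F \<omega>) x))) \<in> borel_measurable M" by measurable
qed

text \<open>
Contracting the last index of an array with a vector multiplies the Euclidean norm by at most the
norm of that vector. Iterated, this bounds matrix-vector products and the cubic form of the third
derivatives by Euclidean norms of arrays.
\<close>

lemma norm_contraction_le:
  fixes T :: "('b::real_inner)^'n" and w :: "real^'n"
  assumes "\<And>i. \<bar>w $ i\<bar> \<le> norm (T $ i) * K" and "0 \<le> K"
  shows "norm w \<le> norm T * K"
proof -
  have "norm w \<le> norm ((\<chi> i. K * norm (T $ i)) :: real^'n)"
    using assms by (intro norm_le_componentwise_cart) (auto simp: mult.commute)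
  also have "\<dots> = norm T * K"
    using assms(2) by (simp add: norm_vec_def L2_set_def power_mult_distrib real_sqrt_mult mult.commute flip: sum_distrib_left)
  finally show ?thesis .
qed

text \<open>
Taylor's formula with Lagrange remainder for \<open>t \<mapsto> f (x + t h)\<close>. Each derivative in \<open>t\<close>
contracts one more index with \<open>h\<close>, and three contractions cost the factor \<open>|h|\<^sup>3\<close>.
\<close>

lemma taylor_third_order:
  fixes f :: "real^'n \<Rightarrow> real"
  assumes C3: "Ck_on 3 S f"
    and seg: "\<And>t. 0 \<le> t \<Longrightarrow> t \<le> 1 \<Longrightarrow> x + t *\<^sub>R h \<in> S"
    and bound: "\<And>y. y \<in> S \<Longrightarrow> norm (D3 f y) \<le> B"
  shows "\<bar>f (x + h) - f x - D1 f x \<bullet> h - 1/2 * (h \<bullet> (D2 f x *v h))\<bar> \<le> B / 6 * norm h ^ 3"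
proof -
  define g1 where "g1 t = (\<Sum>i\<in>UNIV. h $ i * partial i f (x + t *\<^sub>R h))" for t
  define g2 where "g2 t = (\<Sum>i\<in>UNIV. h $ i * (\<Sum>j\<in>UNIV. h $ j * partial j (partial i f) (x + t *\<^sub>R h)))" for t
  define g3 where "g3 t = (\<Sum>i\<in>UNIV. h $ i * (\<Sum>j\<in>UNIV. h $ j *
      (\<Sum>k\<in>UNIV. h $ k * partial k (partial j (partial i f)) (x + t *\<^sub>R h))))" for t
  define diff where "diff m = (if m = 0 then (\<lambda>t. f (x + t *\<^sub>R h)) else if m = 1 then g1
      else if m = 2 then g2 else g3)" for m :: nat
  have C: "y \<in> S \<Longrightarrow> f differentiable (at y)" "y \<in> S \<Longrightarrow> partial i f differentiable (at y)"
      "y \<in> S \<Longrightarrow> partial j (partial i f) differentiable (at y)" for y i j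
    using C3 by (auto simp: numeral_3_eq_3)
  have "DERIV (diff m) t :> diff (Suc m) t" if m: "m < 3" and t: "0 \<le> t" "t \<le> 1" for m t
  proof -
    have y: "x + t *\<^sub>R h \<in> S" using seg t by blast
    consider "m = 0" | "m = 1" | "m = 2" using m by linarith
    then show ?thesis
    proof cases
      case 1
      then show ?thesis using has_real_derivative_along_line[OF C(1)[OF y]]
        by (simp add: diff_def g1_def)
    next
      case 2
      then show ?thesis using has_real_derivative_along_line[OF C(2)[OF y]]
        by (simp add: diff_def g1_def[abs_def] g2_def) (intro DERIV_sum DERIV_cmult)
    next
      case 3
      then show ?thesis using has_real_derivative_along_line[OF C(3)[OF y]]
        by (simp add: diff_def g3_def g2_def[abs_def]) (intro DERIV_sum DERIV_cmult)
    qed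
  qed
  then obtain t where t: "0 < t" "t < 1"
    and eq: "diff 0 1 = (\<Sum>m<3. diff m 0 / fact m * 1 ^ m) + diff 3 t / fact 3 * 1 ^ 3"
    using Maclaurin[of 1 3 diff "diff 0"] by auto
  have D1: "g1 0 = D1 f x \<bullet> h"
    by (simp add: g1_def D1_def inner_vec_def mult.commute)
  have D2: "g2 0 = h \<bullet> (D2 f x *v h)"
    by (simp add: g2_def D2_def inner_vec_def matrix_vector_mult_def mult.commute)
  have "f (x + h) = f x + g1 0 + g2 0 / 2 + g3 t / 6"
    using eq by (simp add: diff_def numeral_3_eq_3 fact_numeral)
  then have remainder: "f (x + h) - f x - D1 f x \<bullet> h - 1/2 * (h \<bullet> (D2 f x *v h)) = g3 t / 6"
    by (simp add: D1 D2)
  have "\<bar>g3 t\<bar> \<le> B * norm h ^ 3"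
  proof -
    let ?T = "D3 f (x + t *\<^sub>R h)"
    define z where "z i = (\<chi> j. ?T $ i $ j \<bullet> h)" for i
    define w where "w = (\<chi> i. z i \<bullet> h)"
    have "g3 t = w \<bullet> h"
      by (simp add: g3_def w_def z_def D3_def inner_vec_def mult.commute)
    then have "\<bar>g3 t\<bar> \<le> norm w * norm h" by (simp add: Cauchy_Schwarz_ineq2)
    moreover have "norm (z i) \<le> norm (?T $ i) * norm h" for i
      by (rule norm_contraction_le) (auto simp: z_def Cauchy_Schwarz_ineq2)
    then have "\<bar>z i \<bullet> h\<bar> \<le> norm (?T $ i) * (norm h * norm h)" for i
      using Cauchy_Schwarz_ineq2[of "z i" h] mult_right_mono[of _ _ "norm h"]
      by (smt (verit) mult.assoc norm_ge_zero)
    then have "norm w \<le> norm ?T * (norm h * norm h)"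
      by (intro norm_contraction_le) (auto simp: w_def)
    ultimately have "\<bar>g3 t\<bar> \<le> norm ?T * norm h ^ 3"
      by (smt (verit) mult.assoc mult_right_mono norm_ge_zero power3_eq_cube)
    also have "\<dots> \<le> B * norm h ^ 3" using bound seg t by (intro mult_right_mono) auto
    finally show ?thesis .
  qed
  then show ?thesis unfolding remainder by simp
qed

section \<open>The log likelihood ratio outside exceptional events\<close>

lemma norm_matrix_vector_mult_le:
  fixes A :: "real^'n^'m"
  shows "norm (A *v u) \<le> norm A * norm u"
  by (rule norm_contraction_le) (auto simp: matrix_vector_mul_component Cauchy_Schwarz_ineq2)

text \<open>
This is the quantitative form of the local quadratic expansion: the error consists of the
fluctuation of the observed information and of the Taylor remainder. It is used with large \<open>u\<close>
for the tail estimate and with fixed \<open>u\<close> for the limit of the remainder.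
\<close>

lemma quadratic_remainder_bound:
  fixes a :: "real \<Rightarrow> real^'n^'n" and H :: "real \<Rightarrow> 'a \<Rightarrow> real^'n \<Rightarrow> real" and G :: "real^'n^'n"
  assumes b: "0 < brate a T"
    and upper: "(norm (a T *v u))\<^sup>2 \<le> C1 / brate a T * (norm u)\<^sup>2" and C1: "0 \<le> C1"
    and C3: "Ck_on 3 \<Theta> (H T \<omega>)" and ball: "ball \<theta>s \<delta> \<subseteq> \<Theta>" and u: "norm (a T *v u) < \<delta>"
    and x: "\<And>\<theta>. \<theta> \<in> \<Theta> \<Longrightarrow> inverse (brate a T) * norm (D3 (H T \<omega>) \<theta>) \<le> x"
  shows "\<bar>H T \<omega> (theta_dag a \<theta>s T u) - H T \<omega> \<theta>s - DeltaT H a \<theta>s T \<omega> \<bullet> u + 1/2 * (u \<bullet> (G *v u))\<bar>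
    \<le> norm (GammaT H a \<theta>s T \<omega> - G) / 2 * (norm u)\<^sup>2
      + sqrt C1 ^ 3 / 6 * x * norm u ^ 3 / sqrt (brate a T)"
proof -
  let ?h = "a T *v u" and ?s = "sqrt (brate a T)" and ?\<Gamma> = "GammaT H a \<theta>s T \<omega>"
  have s: "0 < ?s" "?s\<^sup>2 = brate a T" using b by auto
  have "0 < \<delta>" using u norm_ge_zero[of ?h] by linarith
  then have "\<theta>s \<in> \<Theta>" using ball by auto
  then have x0: "0 \<le> x" using x[of \<theta>s] b
    by (meson inverse_nonnegative_iff_nonnegative less_imp_le mult_nonneg_nonneg norm_ge_zero order_trans)
  have seg: "\<theta>s + t *\<^sub>R ?h \<in> \<Theta>" if "0 \<le> t" "t \<le> 1" for t
  proof -
    have "norm (t *\<^sub>R ?h) \<le> norm ?h" using that by (simp add: mult_left_le_one_le)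
    then show ?thesis using u ball by (auto simp: dist_norm)
  qed
  have "norm (D3 (H T \<omega>) \<theta>) \<le> brate a T * x" if "\<theta> \<in> \<Theta>" for \<theta>
    using x[OF that] b by (simp add: field_simps)
  from taylor_third_order[OF C3 seg this]
  have taylor: "\<bar>H T \<omega> (\<theta>s + ?h) - H T \<omega> \<theta>s - DeltaT H a \<theta>s T \<omega> \<bullet> u + 1/2 * (u \<bullet> (?\<Gamma> *v u))\<bar>
      \<le> brate a T * x / 6 * norm ?h ^ 3"
    unfolding DeltaT_form GammaT_form by simp
  have "norm ?h \<le> sqrt C1 / ?s * norm u"
  proof (rule power2_le_imp_le)
    show "(norm ?h)\<^sup>2 \<le> (sqrt C1 / ?s * norm u)\<^sup>2"
      using upper C1 b by (simp add: power_mult_distrib power_divide)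
  qed (use C1 s in auto)
  then have "norm ?h ^ 3 \<le> (sqrt C1 / ?s * norm u) ^ 3" by (rule power_mono) simp
  then have "brate a T * x / 6 * norm ?h ^ 3 \<le> brate a T * x / 6 * (sqrt C1 / ?s * norm u) ^ 3"
    using b x0 by (intro mult_left_mono) auto
  also have "\<dots> = ?s\<^sup>2 * x / 6 * (sqrt C1 / ?s * norm u) ^ 3"
    by (simp only: s(2))
  also have "\<dots> = sqrt C1 ^ 3 / 6 * x * norm u ^ 3 / ?s"
    using s(1) by (simp add: power_mult_distrib power_divide field_simps power2_eq_square power3_eq_cube)
  finally have cubic: "brate a T * x / 6 * norm ?h ^ 3 \<le> sqrt C1 ^ 3 / 6 * x * norm u ^ 3 / ?s" .
  have "u \<bullet> (?\<Gamma> *v u) - u \<bullet> (G *v u) = u \<bullet> ((?\<Gamma> - G) *v u)"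
    by (simp add: inner_diff_right matrix_vector_mult_diff_rdistrib)
  then have "\<bar>u \<bullet> (?\<Gamma> *v u) - u \<bullet> (G *v u)\<bar> \<le> norm u * norm ((?\<Gamma> - G) *v u)"
    by (simp add: Cauchy_Schwarz_ineq2)
  also have "\<dots> \<le> norm u * (norm (?\<Gamma> - G) * norm u)"
    by (intro mult_left_mono norm_matrix_vector_mult_le) auto
  finally have "\<bar>u \<bullet> (?\<Gamma> *v u) - u \<bullet> (G *v u)\<bar> \<le> norm (?\<Gamma> - G) * (norm u)\<^sup>2"
    by (simp add: power2_eq_square ac_simps)
  then have "\<bar>1/2 * (u \<bullet> (?\<Gamma> *v u)) - 1/2 * (u \<bullet> (G *v u))\<bar> \<le> norm (?\<Gamma> - G) / 2 * (norm u)\<^sup>2"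
    by (simp add: abs_if split: if_splits)
  then show ?thesis using taylor cubic unfolding theta_dag_def by linarith
qed

text \<open>
Here \<open>n = |u|\<close>, \<open>s = b\<^sub>T\<^sup>1\<^sup>/\<^sup>2\<close>, \<open>l\<close> is the smallest eigenvalue of the
information, and \<open>d\<close>, \<open>g\<close>, \<open>t\<close> are the sizes of the linear, the quadratic and the cubic error.
The constraint \<open>n \<le> s\<^sup>1\<^sup>-\<^sup>\<alpha>\<close> means \<open>s \<ge> n\<^sup>1\<^sup>+\<^sup>\<beta>\<close>, so negative powers
of \<open>s\<close> turn into negative powers of \<open>n\<close>, hence of \<open>r\<close>. The quadratic term gains
\<open>2 r\<^sup>-\<^sup>\<rho>\<^sup>1 n\<^sup>2\<close> and each of the three errors costs at most an eighth of that.
\<close>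

lemma quadratic_regime_estimate:
  fixes r n s d g t :: real
  assumes r: "1 \<le> r" "r \<le> n" and s: "0 < s" "n \<le> s powr (1 - \<alpha>)"
    and par: "0 < \<alpha>" "\<alpha> < 1" "\<beta> = \<alpha> / (1 - \<alpha>)" "0 < \<beta>1"
    and l: "4 * r powr - \<rho>1 \<le> l"
    and d: "d \<le> 1/4 * r powr (1 - \<rho>1)"
    and g: "s powr (2 * \<beta>1) * g \<le> 1/2 * r powr (2 * \<beta>1 / (1 - \<alpha>) - \<rho>1)"
    and t: "0 \<le> t" "t \<le> 1/4 * r powr (\<beta> - \<rho>1)"
  shows "d * n - 1/2 * (l * n\<^sup>2) + (g / 2 * n\<^sup>2 + t * n ^ 3 / s) \<le> - (r powr (2 - \<rho>1))"
proof -
  let ?q = "r powr - \<rho>1"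
  have n: "0 < n" "0 < r" using r by auto
  have "n powr (1 / (1 - \<alpha>)) \<le> (s powr (1 - \<alpha>)) powr (1 / (1 - \<alpha>))"
    using s n par by (intro powr_mono2) auto
  also have "\<dots> = s" using par s by (simp add: powr_powr)
  finally have ns: "n powr (1 / (1 - \<alpha>)) \<le> s" .
  have exps: "1 / (1 - \<alpha>) = 1 + \<beta>" using par by (simp add: field_simps)
  have \<beta>: "0 < \<beta>" using par by simp
  have dn: "d * n \<le> 1/4 * ?q * n\<^sup>2"
  proof -
    have "d * n \<le> (1/4 * r powr (1 - \<rho>1)) * n" using d n by (intro mult_right_mono) auto
    also have "\<dots> = 1/4 * ?q * (r * n)" using n by (simp add: powr_diff powr_minus field_simps)
    also have "\<dots> \<le> 1/4 * ?q * n\<^sup>2"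
      using r n by (intro mult_left_mono) (auto simp: power2_eq_square)
    finally show ?thesis .
  qed
  have ln: "4 * ?q * n\<^sup>2 \<le> l * n\<^sup>2" using l by (intro mult_right_mono) auto
  have gn: "g / 2 * n\<^sup>2 \<le> 1/4 * ?q * n\<^sup>2"
  proof -
    have "r powr (2 * \<beta>1 / (1 - \<alpha>)) \<le> n powr (2 * \<beta>1 / (1 - \<alpha>))"
      using r n par by (intro powr_mono2) auto
    also have "\<dots> = (n powr (1 / (1 - \<alpha>))) powr (2 * \<beta>1)" by (simp add: powr_powr)
    also have "\<dots> \<le> s powr (2 * \<beta>1)" using ns par n by (intro powr_mono2) auto
    finally have "r powr (2 * \<beta>1 / (1 - \<alpha>)) * ?q \<le> s powr (2 * \<beta>1) * ?q"
      by (rule mult_right_mono) simp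
    moreover have "r powr (2 * \<beta>1 / (1 - \<alpha>) - \<rho>1) = r powr (2 * \<beta>1 / (1 - \<alpha>)) * ?q"
      by (simp add: powr_diff powr_minus divide_inverse)
    ultimately have "s powr (2 * \<beta>1) * g \<le> s powr (2 * \<beta>1) * (1/2 * ?q)" using g by linarith
    then have "g \<le> 1/2 * ?q" using s by simp
    then show ?thesis by (intro mult_right_mono) auto
  qed
  have tn: "t * n ^ 3 / s \<le> 1/4 * ?q * n\<^sup>2"
  proof -
    have "n * r powr \<beta> \<le> n * n powr \<beta>" using r n \<beta> by (intro mult_left_mono powr_mono2) auto
    also have "\<dots> = n powr (1 + \<beta>)" using n by (simp add: powr_add)
    also have "\<dots> \<le> s" using ns exps by simp
    finally have "n * r powr \<beta> / s \<le> 1" using s by simp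
    then have "1/4 * ?q * n\<^sup>2 * (n * r powr \<beta> / s) \<le> 1/4 * ?q * n\<^sup>2"
      by (intro mult_left_le) auto
    moreover have "t * n ^ 3 / s \<le> (1/4 * r powr (\<beta> - \<rho>1)) * n ^ 3 / s"
      using t n s by (intro divide_right_mono mult_right_mono) auto
    moreover have "(1/4 * r powr (\<beta> - \<rho>1)) * n ^ 3 / s = 1/4 * ?q * n\<^sup>2 * (n * r powr \<beta> / s)"
      by (simp add: powr_diff powr_minus power2_eq_square power3_eq_cube field_simps)
    ultimately show ?thesis by linarith
  qed
  have "r powr (2 - \<rho>1) = ?q * r\<^sup>2" using n by (simp add: powr_diff powr_minus field_simps)
  also have "\<dots> \<le> ?q * n\<^sup>2" using r n by (intro mult_left_mono power_mono) auto
  finally have "r powr (2 - \<rho>1) \<le> ?q * n\<^sup>2" .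
  moreover have "0 \<le> ?q * n\<^sup>2" by simp
  ultimately show ?thesis using dn ln gn tn by linarith
qed

text \<open>
Here \<open>h = |\<theta> - \<theta>\<^sup>*|\<close> and \<open>s = b\<^sub>T\<^sup>1\<^sup>/\<^sup>2\<close>. As \<open>n \<ge> s\<^sup>1\<^sup>-\<^sup>\<alpha>\<close> forces
\<open>h \<ge> s\<^sup>-\<^sup>\<alpha>\<close>, the separation of \<open>Y\<close> drives \<open>s\<^sup>2 Y\<close> below
\<open>-\<kappa> s\<^sup>2\<^sup>-\<^sup>\<alpha>\<^sup>\<rho>\<close>. Boundedness of the parameter set, in the form \<open>r \<le> D s\<close>, converts
the positive power of \<open>s\<close> into a power of \<open>r\<close>; the powers of \<open>D\<close> in the assumptions on
\<open>\<kappa>\<close> and on \<open>yT - y\<close> pay for this conversion.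
\<close>

lemma separation_regime_estimate:
  fixes r n s D \<kappa> h y yT :: real
  assumes r: "1 \<le> r" "r \<le> D * s" and s: "0 < s" "s powr (1 - \<alpha>) \<le> n" and D: "0 < D"
    and par: "0 < \<alpha>" "0 < \<rho>" "\<alpha> * \<rho> < \<rho>2" "0 \<le> \<beta>2" "0 < 1 - 2 * \<beta>2 - \<rho>2"
    and n: "n \<le> s * h"
    and y: "y \<le> - \<kappa> * h powr \<rho>"
    and X: "s powr (1 - 2 * \<beta>2) * \<bar>yT - y\<bar> \<le> D powr (1 + 2 * \<beta>2) * r powr (1 - 2 * \<beta>2 - \<rho>2)"
    and \<kappa>: "2 * D powr (2 - \<alpha> * \<rho>) * r powr - (\<rho>2 - \<alpha> * \<rho>) \<le> \<kappa>"
  shows "s\<^sup>2 * yT \<le> - (r powr (2 - \<rho>2))"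
proof -
  have r0: "0 < r" using r by simp
  have "0 < s powr (1 - \<alpha>)" using s by simp
  then have "0 < n" using s by linarith
  then have h: "0 < h" using n s zero_less_mult_pos[of s h] by linarith
  have \<kappa>0: "0 \<le> \<kappa>" by (rule order_trans[OF _ \<kappa>]) simp
  have "s powr - \<alpha> = s powr (1 - \<alpha>) / s" using s by (simp add: powr_diff powr_minus field_simps)
  also have "\<dots> \<le> h" using s n by (simp add: field_simps)
  finally have "(s powr - \<alpha>) powr \<rho> \<le> h powr \<rho>" using par s by (intro powr_mono2) auto
  then have "s\<^sup>2 * s powr - (\<alpha> * \<rho>) \<le> s\<^sup>2 * h powr \<rho>" by (simp add: powr_powr mult_left_mono)
  then have hs: "s powr (2 - \<alpha> * \<rho>) \<le> s\<^sup>2 * h powr \<rho>"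
    using s by (simp add: powr_diff powr_minus divide_inverse)
  let ?w = "D powr (2 - \<alpha> * \<rho>) * s powr (2 - \<alpha> * \<rho>) * r powr - (\<rho>2 - \<alpha> * \<rho>)"
  have "2 * ?w = (2 * D powr (2 - \<alpha> * \<rho>) * r powr - (\<rho>2 - \<alpha> * \<rho>)) * s powr (2 - \<alpha> * \<rho>)" by simp
  also have "\<dots> \<le> \<kappa> * (s\<^sup>2 * h powr \<rho>)"
    using \<kappa> hs \<kappa>0 by (intro mult_mono) auto
  finally have w: "2 * ?w \<le> - (s\<^sup>2 * y)"
    using mult_left_mono[OF y, of "s\<^sup>2"] by (simp add: algebra_simps)
  have rpow: "r powr (1 - 2 * \<beta>2 - \<rho>2) = r powr (1 - 2 * \<beta>2 - \<alpha> * \<rho>) * r powr - (\<rho>2 - \<alpha> * \<rho>)"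
    unfolding powr_add[symmetric] by (rule arg_cong) simp
  \<comment> \<open>The fluctuation of \<open>yT\<close> around \<open>y\<close> takes at most half of the separation \<open>2 w\<close>.\<close>
  have "s\<^sup>2 * \<bar>yT - y\<bar> = s powr (1 + 2 * \<beta>2) * (s powr (1 - 2 * \<beta>2) * \<bar>yT - y\<bar>)"
  proof -
    have "s\<^sup>2 = s powr (1 + 2 * \<beta>2) * s powr (1 - 2 * \<beta>2)" using s by (simp flip: powr_add)
    then show ?thesis by simp
  qed
  also have "\<dots> \<le> s powr (1 + 2 * \<beta>2) * (D powr (1 + 2 * \<beta>2) * r powr (1 - 2 * \<beta>2 - \<rho>2))"
    using X by (intro mult_left_mono) auto
  also have "\<dots> = (D * s) powr (1 + 2 * \<beta>2) * (r powr (1 - 2 * \<beta>2 - \<alpha> * \<rho>) * r powr - (\<rho>2 - \<alpha> * \<rho>))"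
    unfolding rpow by (simp add: powr_mult ac_simps)
  also have "\<dots> \<le> (D * s) powr (1 + 2 * \<beta>2) * ((D * s) powr (1 - 2 * \<beta>2 - \<alpha> * \<rho>) * r powr - (\<rho>2 - \<alpha> * \<rho>))"
    using par r r0 by (intro mult_left_mono mult_right_mono powr_mono2) auto
  also have "\<dots> = (D * s) powr (2 - \<alpha> * \<rho>) * r powr - (\<rho>2 - \<alpha> * \<rho>)"
  proof -
    have "(D * s) powr (1 + 2 * \<beta>2) * (D * s) powr (1 - 2 * \<beta>2 - \<alpha> * \<rho>) = (D * s) powr (2 - \<alpha> * \<rho>)"
      unfolding powr_add[symmetric] by (rule arg_cong) simp
    then show ?thesis by (simp only: mult.assoc[symmetric])
  qed
  also have "\<dots> = ?w" using D s by (simp add: powr_mult)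
  finally have fluct: "s\<^sup>2 * \<bar>yT - y\<bar> \<le> ?w" .
  have "s\<^sup>2 * yT \<le> s\<^sup>2 * y + s\<^sup>2 * \<bar>yT - y\<bar>"
    by (simp flip: distrib_left add: mult_left_mono)
  then have main: "s\<^sup>2 * yT \<le> - ?w" using w fluct by linarith
  have "r powr (2 - \<rho>2) = r powr (2 - \<alpha> * \<rho>) * r powr - (\<rho>2 - \<alpha> * \<rho>)"
    unfolding powr_add[symmetric] by (rule arg_cong) simp
  also have "\<dots> \<le> (D * s) powr (2 - \<alpha> * \<rho>) * r powr - (\<rho>2 - \<alpha> * \<rho>)"
    using par r r0 by (intro mult_right_mono powr_mono2) auto
  also have "\<dots> = ?w" using D s by (simp add: powr_mult)
  finally show ?thesis using main by linarith
qed

text \<open>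
The two regimes meet at \<open>|u| = b\<^sub>T\<^sup>(\<^sup>1\<^sup>-\<^sup>\<alpha>\<^sup>)\<^sup>/\<^sup>2\<close>. In the inner one
\<open>|a\<^sub>T u|\<close> is at most of order \<open>b\<^sub>T\<^sup>-\<^sup>\<alpha>\<^sup>/\<^sup>2\<close>. Since the parameter set is only
connected, Taylor's formula needs \<open>a\<^sub>T u\<close> to stay in a ball around the true value. This holds
for large \<open>r\<close>, uniformly in \<open>T\<close>: if \<open>b\<^sub>T\<close> is too small, no admissible \<open>u\<close> has norm at least \<open>r\<close>.
\<close>

lemma log_likelihood_ratio_bound:
  fixes a :: "real \<Rightarrow> real^'n^'n" and H :: "real \<Rightarrow> 'a \<Rightarrow> real^'n \<Rightarrow> real"
    and Y :: "'a \<Rightarrow> real^'n \<Rightarrow> real" and G :: "real^'n^'n"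
  assumes b: "0 < brate a T"
    and lower: "\<And>u. (norm u)\<^sup>2 \<le> brate a T * (norm (a T *v u))\<^sup>2"
    and upper: "\<And>u. (norm (a T *v u))\<^sup>2 \<le> C1 / brate a T * (norm u)\<^sup>2" and C1: "1 \<le> C1"
    and C3: "Ck_on 3 \<Theta> (H T \<omega>)" and ball: "ball \<theta>s \<delta> \<subseteq> \<Theta>"
    and D: "0 < D" "\<And>\<theta>. \<theta> \<in> \<Theta> \<Longrightarrow> norm (\<theta> - \<theta>s) \<le> D"
    and par: "0 < \<alpha>" "\<alpha> < 1" "\<beta> = \<alpha> / (1 - \<alpha>)" "0 < \<beta>1" "0 < \<rho>" "\<alpha> * \<rho> < \<rho>2" "0 \<le> \<beta>2"
      "0 < 1 - 2 * \<beta>2 - \<rho>2"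
    and r: "1 \<le> r" "sqrt C1 * (r / D) powr - \<alpha> < \<delta>"
    and Y: "\<And>\<theta>. \<theta> \<in> \<Theta> \<Longrightarrow> Y \<omega> \<theta> \<le> - \<kappa> * norm (\<theta> - \<theta>s) powr \<rho>"
    and sym: "transpose G = G"
    and good_\<kappa>: "2 * D powr (2 - \<alpha> * \<rho>) * r powr - (\<rho>2 - \<alpha> * \<rho>) \<le> \<kappa>"
    and good_\<Gamma>: "4 * r powr - \<rho>1 \<le> lambda_min G"
    and good_\<Delta>: "norm (DeltaT H a \<theta>s T \<omega>) \<le> 1/4 * r powr (1 - \<rho>1)"
    and good_Y: "\<And>\<theta>. \<theta> \<in> \<Theta> \<Longrightarrow> brate a T powr (1/2 - \<beta>2) * \<bar>YT H a \<theta>s T \<omega> \<theta> - Y \<omega> \<theta>\<bar>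
        \<le> D powr (1 + 2 * \<beta>2) * r powr (1 - 2 * \<beta>2 - \<rho>2)"
    and good_D3: "\<And>\<theta>. \<theta> \<in> \<Theta> \<Longrightarrow> inverse (brate a T) * norm (D3 (H T \<omega>) \<theta>)
        \<le> 3 / (2 * sqrt C1 ^ 3) * r powr (\<beta> - \<rho>1)"
    and good_GT: "brate a T powr \<beta>1 * norm (GammaT H a \<theta>s T \<omega> - G)
        \<le> 1/2 * r powr (2 * \<beta>1 / (1 - \<alpha>) - \<rho>1)"
    and u: "u \<in> VV \<Theta> a \<theta>s T r"
  shows "H T \<omega> (theta_dag a \<theta>s T u) - H T \<omega> \<theta>s \<le> - (r powr (2 - max \<rho>1 \<rho>2))"
proof -
  define s where "s = sqrt (brate a T)"
  have s: "0 < s" and s2: "s\<^sup>2 = brate a T" using b by (auto simp: s_def)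
  have bs: "brate a T powr x = s powr (2 * x)" for x
  proof -
    have "brate a T = s powr 2" using s by (simp add: s2)
    then show ?thesis by (simp add: powr_powr)
  qed
  let ?h = "a T *v u"
  have \<Theta>: "\<theta>s + ?h \<in> \<Theta>" and ru: "r \<le> norm u" using u by (auto simp: VV_def UU_def theta_dag_def)
  have nD: "norm ?h \<le> D" using D(2)[OF \<Theta>] by simp
  have un: "norm u \<le> s * norm ?h"
  proof (rule power2_le_imp_le)
    show "(norm u)\<^sup>2 \<le> (s * norm ?h)\<^sup>2" using lower[of u] by (simp add: power_mult_distrib s2)
  qed (use s in auto)
  also have "\<dots> \<le> D * s" using nD s by (simp add: mult.commute mult_left_mono)
  finally have rD: "r \<le> D * s" using ru by linarith
  have r0: "0 < r" using r by simp
  have mono: "- (r powr (2 - \<rho>')) \<le> - (r powr (2 - max \<rho>1 \<rho>2))" if "\<rho>' \<le> max \<rho>1 \<rho>2" for \<rho>'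
    using r that by (auto intro: powr_mono)
  show ?thesis
  proof (cases "norm u \<le> s powr (1 - \<alpha>)")
    case True
    have "norm ?h \<le> sqrt C1 / s * norm u"
    proof (rule power2_le_imp_le)
      show "(norm ?h)\<^sup>2 \<le> (sqrt C1 / s * norm u)\<^sup>2"
        using upper[of u] C1 b by (simp add: power_mult_distrib power_divide s2)
    qed (use C1 s in auto)
    also have "\<dots> \<le> sqrt C1 / s * s powr (1 - \<alpha>)" using True s C1 by (intro mult_left_mono) auto
    also have "\<dots> = sqrt C1 * s powr - \<alpha>" using s by (simp add: powr_diff powr_minus field_simps)
    also have "\<dots> \<le> sqrt C1 * (r / D) powr - \<alpha>"
      using rD r0 D(1) C1 par by (intro mult_left_mono powr_mono2') (auto simp: field_simps)
    also have "\<dots> < \<delta>" by (rule r(2))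
    finally have small: "norm ?h < \<delta>" .
    let ?x = "3 / (2 * sqrt C1 ^ 3) * r powr (\<beta> - \<rho>1)"
    let ?t = "sqrt C1 ^ 3 / 6 * ?x"
    have t: "?t = 1/4 * r powr (\<beta> - \<rho>1)" using C1 by simp
    have "H T \<omega> (theta_dag a \<theta>s T u) - H T \<omega> \<theta>s
        \<le> DeltaT H a \<theta>s T \<omega> \<bullet> u - 1/2 * (u \<bullet> (G *v u))
          + (norm (GammaT H a \<theta>s T \<omega> - G) / 2 * (norm u)\<^sup>2 + ?t * norm u ^ 3 / s)"
      using quadratic_remainder_bound[where a=a and T=T and H=H and \<omega>=\<omega> and \<theta>s=\<theta>s and u=u
          and x="?x" and G=G, OF b upper _ C3 ball small good_D3] C1
      unfolding s_def by linarith
    also have "\<dots> \<le> norm (DeltaT H a \<theta>s T \<omega>) * norm u - 1/2 * (lambda_min G * (norm u)\<^sup>2)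
          + (norm (GammaT H a \<theta>s T \<omega> - G) / 2 * (norm u)\<^sup>2 + ?t * norm u ^ 3 / s)"
      using lambda_min_minimum(2)[OF sym, of u] norm_cauchy_schwarz[of "DeltaT H a \<theta>s T \<omega>" u] by linarith
    also have "\<dots> \<le> - (r powr (2 - \<rho>1))"
      using good_GT t
      by (intro quadratic_regime_estimate[OF r(1) ru s True par(1-4) good_\<Gamma> good_\<Delta>]) (auto simp: bs)
    also have "\<dots> \<le> - (r powr (2 - max \<rho>1 \<rho>2))" by (rule mono) simp
    finally show ?thesis .
  next
    case False
    have YT: "H T \<omega> (theta_dag a \<theta>s T u) - H T \<omega> \<theta>s = s\<^sup>2 * YT H a \<theta>s T \<omega> (\<theta>s + ?h)"
      using b by (simp add: YT_def s2 theta_dag_def)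
    have "s\<^sup>2 * YT H a \<theta>s T \<omega> (\<theta>s + ?h) \<le> - (r powr (2 - \<rho>2))"
    proof (rule separation_regime_estimate[OF r(1) rD s _ D(1) par(1,5-8) un _ _ good_\<kappa>])
      show "Y \<omega> (\<theta>s + ?h) \<le> - \<kappa> * norm ?h powr \<rho>" using Y[OF \<Theta>] by simp
      show "s powr (1 - 2 * \<beta>2) * \<bar>YT H a \<theta>s T \<omega> (\<theta>s + ?h) - Y \<omega> (\<theta>s + ?h)\<bar>
          \<le> D powr (1 + 2 * \<beta>2) * r powr (1 - 2 * \<beta>2 - \<rho>2)"
        using good_Y[OF \<Theta>] by (simp add: bs algebra_simps)
    qed (use False in simp)
    also have "\<dots> \<le> - (r powr (2 - max \<rho>1 \<rho>2))" by (rule mono) simp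
    finally show ?thesis unfolding YT .
  qed
qed

section \<open>Polynomial bounds for conditional tails\<close>

lemma add_less_oneD:
  fixes x y :: ennreal
  assumes "x + y < 1"
  shows "x < 1" "y < 1"
proof -
  have "x \<le> x + y" "y \<le> x + y" by (simp_all add: add_increasing add_increasing2)
  then show "x < 1" "y < 1" using assms by (blast intro: le_less_trans)+
qed

lemma SUP_ennreal_less_imp_le:
  assumes "(SUP x\<in>S. ennreal (f x)) < ennreal c" "x \<in> S"
  shows "f x \<le> c"
proof (rule ccontr)
  assume "\<not> f x \<le> c"
  then have "ennreal c \<le> ennreal (f x)" by (intro ennreal_leI) simp
  also have "\<dots> \<le> (SUP x\<in>S. ennreal (f x))" by (rule SUP_upper[OF assms(2)])
  finally show False using assms(1) by simp
qed

lemma AE_finite_SUP_mono: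
  fixes f g :: "nat \<Rightarrow> nat \<Rightarrow> 'a \<Rightarrow> ennreal"
  assumes "AE \<omega> in M. (SUP n. SUP r\<in>{1..}. f n r \<omega>) < \<infinity>"
    and "\<And>n r. 1 \<le> r \<Longrightarrow> AE \<omega> in M. g n r \<omega> \<le> f n r \<omega>"
  shows "AE \<omega> in M. (SUP n. SUP r\<in>{1..}. g n r \<omega>) < \<infinity>"
proof -
  have "AE \<omega> in M. \<forall>n r. 1 \<le> r \<longrightarrow> g n r \<omega> \<le> f n r \<omega>"
    unfolding AE_all_countable using assms(2) by auto
  with assms(1) show ?thesis
  proof eventually_elim
    case (elim \<omega>)
    have "(SUP n. SUP r\<in>{1..}. g n r \<omega>) \<le> (SUP n. SUP r\<in>{1..}. f n r \<omega>)"
      by (rule SUP_mono', rule SUP_subset_mono) (use elim(2) in auto)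
    then show ?case using elim(1) by (rule le_less_trans)
  qed
qed

text \<open>
A random quantity with this property contributes a term of order \<open>r\<^sup>-\<^sup>L\<close>, uniformly in \<open>n\<close>, to a
conditional probability that it dominates, once this is weighted with \<open>\<psi>\<close>. Stability under sums
lets a tail event be treated one exceptional event at a time, and the null sets of all \<open>n\<close> and \<open>r\<close>
are collected inside the predicate.
\<close>

definition cond_tail_bounded ::
  "'a measure \<Rightarrow> 'a measure \<Rightarrow> (nat \<Rightarrow> 'a \<Rightarrow> ennreal) \<Rightarrow> real \<Rightarrow> (nat \<Rightarrow> nat \<Rightarrow> 'a \<Rightarrow> ennreal) \<Rightarrow> bool" where
  "cond_tail_bounded M F \<psi> L f \<longleftrightarrow> (\<forall>n r. f n r \<in> borel_measurable M) \<and>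
     (AE \<omega> in M. (SUP n. SUP r\<in>{1..}. ennreal (real r powr L) * nn_cond_exp M F (f n r) \<omega> * \<psi> n \<omega>) < \<infinity>)"

context finite_measure_subalgebra
begin

text \<open>
The dominated family \<open>g\<close> may fail to be measurable; \<^const>\<open>nn_cond_exp\<close> is then \<open>0\<close>. This
covers events about suprema over uncountable sets.
\<close>

lemma cond_tail_bounded_dominate:
  assumes f: "cond_tail_bounded M F \<psi> L f"
    and le: "\<And>n r. 1 \<le> r \<Longrightarrow> AE \<omega> in M. g n r \<omega> \<le> f n r \<omega>"
  shows "AE \<omega> in M. (SUP n. SUP r\<in>{1..}. ennreal (real r powr L) * nn_cond_exp M F (g n r) \<omega> * \<psi> n \<omega>) < \<infinity>"
proof (rule AE_finite_SUP_mono)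
  show "AE \<omega> in M. (SUP n. SUP r\<in>{1..}. ennreal (real r powr L) * nn_cond_exp M F (f n r) \<omega> * \<psi> n \<omega>) < \<infinity>"
    using f by (simp add: cond_tail_bounded_def)
next
  fix n r :: nat assume r: "1 \<le> r"
  have "AE \<omega> in M. nn_cond_exp M F (g n r) \<omega> \<le> nn_cond_exp M F (f n r) \<omega>"
  proof (cases "g n r \<in> borel_measurable M")
    case True
    then show ?thesis using f le[OF r] by (intro nn_cond_exp_mono) (auto simp: cond_tail_bounded_def)
  next
    case False
    then show ?thesis by (simp add: nn_cond_exp_def)
  qed
  then show "AE \<omega> in M. ennreal (real r powr L) * nn_cond_exp M F (g n r) \<omega> * \<psi> n \<omega>
      \<le> ennreal (real r powr L) * nn_cond_exp M F (f n r) \<omega> * \<psi> n \<omega>"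
    by eventually_elim (intro mult_mono, auto)
qed

lemma cond_tail_bounded_add:
  assumes f: "cond_tail_bounded M F \<psi> L f" and g: "cond_tail_bounded M F \<psi> L g"
  shows "cond_tail_bounded M F \<psi> L (\<lambda>n r \<omega>. f n r \<omega> + g n r \<omega>)"
proof -
  have [measurable]: "f n r \<in> borel_measurable M" "g n r \<in> borel_measurable M" for n r
    using f g by (auto simp: cond_tail_bounded_def)
  let ?S = "\<lambda>h \<omega>. SUP n. SUP r\<in>{1..}. ennreal (real r powr L) * nn_cond_exp M F (h n r) \<omega> * \<psi> n \<omega>"
  have "AE \<omega> in M. \<forall>n r. nn_cond_exp M F (f n r) \<omega> + nn_cond_exp M F (g n r) \<omega>
      = nn_cond_exp M F (\<lambda>\<omega>. f n r \<omega> + g n r \<omega>) \<omega>"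
    unfolding AE_all_countable by (intro allI nn_cond_exp_sum) auto
  moreover have "AE \<omega> in M. ?S f \<omega> < \<infinity>" "AE \<omega> in M. ?S g \<omega> < \<infinity>"
    using f g by (auto simp: cond_tail_bounded_def)
  ultimately have "AE \<omega> in M. ?S (\<lambda>n r \<omega>. f n r \<omega> + g n r \<omega>) \<omega> < \<infinity>"
  proof eventually_elim
    case (elim \<omega>)
    have "?S (\<lambda>n r \<omega>. f n r \<omega> + g n r \<omega>) \<omega> \<le> ?S f \<omega> + ?S g \<omega>"
    proof (intro SUP_least)
      fix n r :: nat assume r: "r \<in> {1..}"
      have "ennreal (real r powr L) * nn_cond_exp M F (\<lambda>\<omega>. f n r \<omega> + g n r \<omega>) \<omega> * \<psi> n \<omega>
          = ennreal (real r powr L) * nn_cond_exp M F (f n r) \<omega> * \<psi> n \<omega>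
            + ennreal (real r powr L) * nn_cond_exp M F (g n r) \<omega> * \<psi> n \<omega>"
        by (simp add: elim(1)[rule_format, symmetric] algebra_simps)
      also have "\<dots> \<le> ?S f \<omega> + ?S g \<omega>"
        by (intro add_mono SUP_upper2[of n] SUP_upper[OF r]) auto
      finally show "ennreal (real r powr L) * nn_cond_exp M F (\<lambda>\<omega>. f n r \<omega> + g n r \<omega>) \<omega> * \<psi> n \<omega>
          \<le> ?S f \<omega> + ?S g \<omega>" .
    qed
    also have "\<dots> < \<infinity>" using elim(2,3) by (simp add: less_top[symmetric])
    finally show ?case .
  qed
  then show ?thesis by (simp add: cond_tail_bounded_def)
qed

lemma cond_tail_bounded_power:
  assumes [measurable]: "\<And>n. G n \<in> borel_measurable M"
    and fin: "AE \<omega> in M. (SUP n. nn_cond_exp M F (G n) \<omega> * \<psi> n \<omega>) < \<infinity>"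
  shows "cond_tail_bounded M F \<psi> L (\<lambda>n r \<omega>. ennreal (c * real r powr - L) * G n \<omega>)"
proof -
  have "AE \<omega> in M. \<forall>n r. ennreal (c * real r powr - L) * nn_cond_exp M F (G n) \<omega>
      = nn_cond_exp M F (\<lambda>\<omega>. ennreal (c * real r powr - L) * G n \<omega>) \<omega>"
    unfolding AE_all_countable by (intro allI nn_cond_exp_prod) auto
  with fin have "AE \<omega> in M. (SUP n. SUP r\<in>{1..}. ennreal (real r powr L)
      * nn_cond_exp M F (\<lambda>\<omega>. ennreal (c * real r powr - L) * G n \<omega>) \<omega> * \<psi> n \<omega>) < \<infinity>"
  proof eventually_elim
    case (elim \<omega>)
    let ?S = "SUP n. nn_cond_exp M F (G n) \<omega> * \<psi> n \<omega>"
    have "(SUP n. SUP r\<in>{1..}. ennreal (real r powr L)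
      * nn_cond_exp M F (\<lambda>\<omega>. ennreal (c * real r powr - L) * G n \<omega>) \<omega> * \<psi> n \<omega>) \<le> ennreal c * ?S"
    proof (intro SUP_least)
      fix n r :: nat assume "r \<in> {1..}"
      then have "real r powr L * (c * real r powr - L) = c"
        by (simp add: powr_minus field_simps)
      then have "ennreal (real r powr L) * ennreal (c * real r powr - L) = ennreal c"
        by (metis ennreal_mult' powr_ge_zero)
      then have "ennreal (real r powr L)
          * nn_cond_exp M F (\<lambda>\<omega>. ennreal (c * real r powr - L) * G n \<omega>) \<omega> * \<psi> n \<omega>
          = ennreal c * (nn_cond_exp M F (G n) \<omega> * \<psi> n \<omega>)"
        by (metis (no_types, lifting) elim(2) mult.assoc)
      also have "\<dots> \<le> ennreal c * ?S"
        by (intro mult_left_mono SUP_upper) auto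
      finally show "ennreal (real r powr L)
          * nn_cond_exp M F (\<lambda>\<omega>. ennreal (c * real r powr - L) * G n \<omega>) \<omega> * \<psi> n \<omega> \<le> ennreal c * ?S" .
    qed
    also have "\<dots> < \<infinity>" using elim(1) by (simp add: ennreal_mult_less_top)
    finally show ?case .
  qed
  then show ?thesis by (simp add: cond_tail_bounded_def)
qed

lemma cond_tail_bounded_time_independent:
  assumes "\<And>r. g r \<in> borel_measurable M" "\<And>n \<omega>. \<omega> \<in> space M \<Longrightarrow> \<psi> n \<omega> \<le> 1"
    and "AE \<omega> in M. (SUP r\<in>{1::nat..}. ennreal (real r powr L) * nn_cond_exp M F (g r) \<omega>) < \<infinity>"
  shows "cond_tail_bounded M F \<psi> L (\<lambda>n r. g r)"
proof -
  have "AE \<omega> in M. (SUP n::nat. SUP r\<in>{1::nat..}. ennreal (real r powr L) * nn_cond_exp M F (g r) \<omega>) < \<infinity>"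
    using assms(3) by simp
  then have "AE \<omega> in M. (SUP n::nat. SUP r\<in>{1::nat..}. ennreal (real r powr L) * nn_cond_exp M F (g r) \<omega> * \<psi> n \<omega>) < \<infinity>"
  proof (rule AE_finite_SUP_mono)
    fix n r :: nat
    have "x * \<psi> n \<omega> \<le> x" if "\<omega> \<in> space M" for x \<omega>
      using mult_left_mono[OF assms(2)[OF that, of n], of x] by simp
    then show "AE \<omega> in M. ennreal (real r powr L) * nn_cond_exp M F (g r) \<omega> * \<psi> n \<omega>
        \<le> ennreal (real r powr L) * nn_cond_exp M F (g r) \<omega>"
      by (intro AE_I2) auto
  qed
  with assms(1) show ?thesis by (simp add: cond_tail_bounded_def)
qed

lemma nn_cond_exp_le_1:
  assumes "f \<in> borel_measurable M" "AE \<omega> in M. f \<omega> \<le> 1"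
  shows "AE \<omega> in M. nn_cond_exp M F f \<omega> \<le> 1"
proof -
  have "AE \<omega> in M. nn_cond_exp M F f \<omega> \<le> nn_cond_exp M F (\<lambda>_. 1) \<omega>"
    using assms by (intro nn_cond_exp_mono) auto
  moreover have "AE \<omega> in M. 1 = nn_cond_exp M F (\<lambda>_. 1) \<omega>"
    by (intro nn_cond_exp_F_meas) auto
  ultimately show ?thesis by eventually_elim auto
qed

text \<open>
Polynomial tails survive a dilation of \<open>r\<close>: replacing \<open>r\<close> by \<open>r div k\<close> costs the factor
\<open>(2 k)\<^sup>L\<close> when \<open>r \<ge> k\<close>, and the finitely many smaller \<open>r\<close> are harmless. A constant factor in
front of a power of \<open>r\<close> in a tail event can be absorbed in this way.
\<close>

lemma cond_tail_rescale:
  fixes g h :: "nat \<Rightarrow> 'a \<Rightarrow> ennreal"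
  assumes [measurable]: "\<And>r. g r \<in> borel_measurable M" "\<And>r. h r \<in> borel_measurable M"
    and h1: "\<And>r \<omega>. \<omega> \<in> space M \<Longrightarrow> h r \<omega> \<le> 1"
    and k: "1 \<le> k" and L: "0 < L"
    and hg: "\<And>r \<omega>. k \<le> r \<Longrightarrow> \<omega> \<in> space M \<Longrightarrow> h r \<omega> \<le> g (r div k) \<omega>"
    and fin: "AE \<omega> in M. (SUP r\<in>{1..}. ennreal (real r powr L) * nn_cond_exp M F (g r) \<omega>) < \<infinity>"
  shows "AE \<omega> in M. (SUP r\<in>{1..}. ennreal (real r powr L) * nn_cond_exp M F (h r) \<omega>) < \<infinity>"
proof -
  have "AE \<omega> in M. \<forall>r. nn_cond_exp M F (h r) \<omega> \<le> 1"
    unfolding AE_all_countable using h1 by (intro allI nn_cond_exp_le_1) auto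
  moreover have "AE \<omega> in M. \<forall>r. k \<le> r \<longrightarrow> nn_cond_exp M F (h r) \<omega> \<le> nn_cond_exp M F (g (r div k)) \<omega>"
    unfolding AE_all_countable
  proof (intro allI)
    fix r show "AE \<omega> in M. k \<le> r \<longrightarrow> nn_cond_exp M F (h r) \<omega> \<le> nn_cond_exp M F (g (r div k)) \<omega>"
    proof (cases "k \<le> r")
      case True
      then have "AE \<omega> in M. nn_cond_exp M F (h r) \<omega> \<le> nn_cond_exp M F (g (r div k)) \<omega>"
        using hg by (intro nn_cond_exp_mono) auto
      then show ?thesis by eventually_elim auto
    qed simp
  qed
  ultimately show ?thesis using fin
  proof eventually_elim
    case (elim \<omega>)
    let ?S = "SUP r\<in>{1..}. ennreal (real r powr L) * nn_cond_exp M F (g r) \<omega>"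
    have "(SUP r\<in>{1..}. ennreal (real r powr L) * nn_cond_exp M F (h r) \<omega>)
        \<le> ennreal (real k powr L) + ennreal (real (2 * k) powr L) * ?S"
    proof (rule SUP_least)
      fix r :: nat assume r: "r \<in> {1..}"
      show "ennreal (real r powr L) * nn_cond_exp M F (h r) \<omega>
        \<le> ennreal (real k powr L) + ennreal (real (2 * k) powr L) * ?S"
      proof (cases "r < k")
        case True
        then have "ennreal (real r powr L) * nn_cond_exp M F (h r) \<omega> \<le> ennreal (real k powr L) * 1"
          using elim(1) L by (intro mult_mono ennreal_leI powr_mono2) auto
        then show ?thesis by (simp add: add_increasing2)
      next
        case False
        let ?q = "r div k"
        have q: "1 \<le> ?q" using False k by (metis div_greater_zero_iff less_eq_Suc_le linorder_not_le One_nat_def order_less_le_trans zero_less_one)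
        have "r < k * ?q + k" using k by (metis Suc_le_eq add_less_cancel_left mod_less_divisor mult_div_mod_eq One_nat_def)
        also have "\<dots> \<le> 2 * k * ?q" using q by (simp add: mult_2 distrib_right)
        finally have "real r \<le> real (2 * k) * real ?q" by (metis less_imp_le of_nat_le_iff of_nat_mult)
        then have "real r powr L \<le> real (2 * k) powr L * real ?q powr L"
          using L by (simp add: powr_mono2 flip: powr_mult)
        then have "ennreal (real r powr L) * nn_cond_exp M F (h r) \<omega>
            \<le> ennreal (real (2 * k) powr L * real ?q powr L) * nn_cond_exp M F (g ?q) \<omega>"
          using elim(2) False by (intro mult_mono ennreal_leI) auto
        also have "\<dots> = ennreal (real (2 * k) powr L) * (ennreal (real ?q powr L) * nn_cond_exp M F (g ?q) \<omega>)"
          by (simp add: ennreal_mult' mult.assoc)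
        also have "\<dots> \<le> ennreal (real (2 * k) powr L) * ?S"
          using q by (intro mult_left_mono SUP_upper) auto
        finally show ?thesis by (simp add: add_increasing)
      qed
    qed
    also have "\<dots> < \<infinity>" using elim(3) by (simp add: ennreal_mult_less_top)
    finally show ?case .
  qed
qed

end

lemma enn_powr_ennreal: "0 \<le> x \<Longrightarrow> enn_powr (ennreal x) p = ennreal (x powr p)"
  by (simp add: enn_powr_def)

lemma borel_measurable_enn_powr [measurable]:
  assumes [measurable]: "X \<in> borel_measurable M"
  shows "(\<lambda>\<omega>. enn_powr (X \<omega>) p) \<in> borel_measurable M"
  unfolding enn_powr_def by measurable

lemma markov_enn_powr:
  assumes "0 < s" "0 < p" "ennreal s \<le> x"
  shows "1 \<le> ennreal (s powr - p) * enn_powr x p"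
proof (cases x)
  case top
  then show ?thesis using assms by (simp add: enn_powr_def ennreal_mult_top)
next
  case (real y)
  then have "s \<le> y" using assms by simp
  then have "s powr p \<le> y powr p" using assms by (intro powr_mono2) auto
  then have "1 \<le> s powr - p * y powr p" using assms by (simp add: powr_minus field_simps)
  then have "ennreal 1 \<le> ennreal (s powr - p * y powr p)" by (rule ennreal_leI)
  then show ?thesis using real by (simp add: enn_powr_ennreal ennreal_mult')
qed

text \<open>
Markov's inequality at the threshold \<open>c r\<^sup>e\<close>; the choice \<open>p = L / e\<close> of the moment turns it into
decay of order \<open>r\<^sup>-\<^sup>L\<close>.
\<close>

lemma markov_enn_powr_tail:
  assumes "0 < c" "0 < r" "0 < e" "0 < L" "p = L / e" "ennreal (c * r powr e) \<le> x"
  shows "1 \<le> ennreal (c powr - p * r powr - L) * enn_powr x p"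
proof -
  have "(c * r powr e) powr - p = c powr - p * r powr - L"
    using assms by (simp add: powr_mult powr_powr)
  then show ?thesis using markov_enn_powr[of "c * r powr e" p x] assms by simp
qed

section \<open>Convergence in probability from conditional moments\<close>

text \<open>
Write \<open>A\<close> for the event at time \<open>n\<close>. Where \<open>\<psi> \<ge> 1/2\<close> one has \<open>1 \<le> 2 \<psi>\<close>, so the probability of
\<open>A\<close> is at most \<open>2 E[1\<^sub>A \<psi>]\<close> plus the vanishing probability of \<open>\<psi> < 1/2\<close>. As \<open>\<psi>\<close> is measurable
for the conditioning field, \<open>E[1\<^sub>A \<psi>]\<close> is the expectation of \<open>\<psi>\<close> times the conditional
probability of \<open>A\<close>. That product is bounded by \<open>1\<close> and, by conditional Markov, by \<open>s\<^sup>-\<^sup>p\<close>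
times a finite random variable, so dominated convergence applies.
\<close>

lemma (in finite_measure_subalgebra) tendsto_measure_of_cond_moments:
  fixes X :: "nat \<Rightarrow> 'a \<Rightarrow> ennreal" and \<psi> :: "nat \<Rightarrow> 'a \<Rightarrow> real"
  assumes X [measurable]: "\<And>n. X n \<in> borel_measurable M"
    and p: "0 < p"
    and fin: "AE \<omega> in M. (SUP n. nn_cond_exp M F (\<lambda>\<omega>. enn_powr (X n \<omega>) p) \<omega> * ennreal (\<psi> n \<omega>)) < \<infinity>"
    and \<psi>F [measurable]: "\<And>n. \<psi> n \<in> borel_measurable F"
    and \<psi>1: "\<And>n \<omega>. \<omega> \<in> space M \<Longrightarrow> \<psi> n \<omega> \<le> 1"
    and \<psi>lim: "(\<lambda>n. measure M {\<omega> \<in> space M. 1 / 2 < \<bar>\<psi> n \<omega> - 1\<bar>}) \<longlonglongrightarrow> 0"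
    and s: "filterlim s at_top sequentially"
  shows "(\<lambda>n. measure M {\<omega> \<in> space M. ennreal (s n) \<le> X n \<omega>}) \<longlonglongrightarrow> 0"
proof -
  define A where "A n = {\<omega> \<in> space M. ennreal (s n) \<le> X n \<omega>}" for n
  define B where "B n = {\<omega> \<in> space M. 1 / 2 < \<bar>\<psi> n \<omega> - 1\<bar>}" for n
  have [measurable]: "\<psi> n \<in> borel_measurable M" for n
    using measurable_from_subalg[OF subalg \<psi>F] .
  have [measurable]: "A n \<in> sets M" "B n \<in> sets M" for n unfolding A_def B_def by measurable
  define v where "v n \<omega> = ennreal (\<psi> n \<omega>) * nn_cond_exp M F (indicator (A n)) \<omega>" for n \<omega>
  have [measurable]: "v n \<in> borel_measurable M" for n unfolding v_def by measurable
  have int: "(\<integral>\<^sup>+\<omega>. ennreal (\<psi> n \<omega>) * indicator (A n) \<omega> \<partial>M) = (\<integral>\<^sup>+\<omega>. v n \<omega> \<partial>M)" for n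
    unfolding v_def by (rule nn_cond_exp_intg[symmetric]) auto
  have le1: "AE \<omega> in M. v n \<omega> \<le> 1" for n
  proof -
    have "AE \<omega> in M. nn_cond_exp M F (indicator (A n)) \<omega> \<le> 1"
      by (intro nn_cond_exp_le_1) (auto simp: indicator_def)
    then show ?thesis using AE_space
    proof eventually_elim
      case (elim \<omega>)
      then have "v n \<omega> \<le> 1 * 1" unfolding v_def using \<psi>1 by (intro mult_mono) (auto simp: ennreal_le_1)
      then show ?case by simp
    qed
  qed
  have lim0: "AE \<omega> in M. (\<lambda>n. v n \<omega>) \<longlonglongrightarrow> 0"
  proof -
    have "AE \<omega> in M. \<forall>n. 0 < s n \<longrightarrow> nn_cond_exp M F (indicator (A n)) \<omega>
        \<le> ennreal (s n powr - p) * nn_cond_exp M F (\<lambda>\<omega>. enn_powr (X n \<omega>) p) \<omega>"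
      unfolding AE_all_countable
    proof
      fix n
      show "AE \<omega> in M. 0 < s n \<longrightarrow> nn_cond_exp M F (indicator (A n)) \<omega>
        \<le> ennreal (s n powr - p) * nn_cond_exp M F (\<lambda>\<omega>. enn_powr (X n \<omega>) p) \<omega>"
      proof (cases "0 < s n")
        case True
        have "AE \<omega> in M. nn_cond_exp M F (indicator (A n)) \<omega>
            \<le> nn_cond_exp M F (\<lambda>\<omega>. ennreal (s n powr - p) * enn_powr (X n \<omega>) p) \<omega>"
          using True p
          by (intro nn_cond_exp_mono AE_I2) (auto simp: A_def indicator_def intro: markov_enn_powr)
        moreover have "AE \<omega> in M. ennreal (s n powr - p) * nn_cond_exp M F (\<lambda>\<omega>. enn_powr (X n \<omega>) p) \<omega>
            = nn_cond_exp M F (\<lambda>\<omega>. ennreal (s n powr - p) * enn_powr (X n \<omega>) p) \<omega>"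
          by (intro nn_cond_exp_prod) auto
        ultimately show ?thesis by eventually_elim auto
      qed simp
    qed
    then show ?thesis using fin
    proof eventually_elim
      case (elim \<omega>)
      let ?S = "SUP n. nn_cond_exp M F (\<lambda>\<omega>. enn_powr (X n \<omega>) p) \<omega> * ennreal (\<psi> n \<omega>)"
      have "((\<lambda>n. s n powr - p) \<longlongrightarrow> 0) sequentially"
        using p s by (intro tendsto_neg_powr) auto
      then have "(\<lambda>n. ennreal (s n powr - p)) \<longlonglongrightarrow> ennreal 0" by (rule tendsto_ennrealI)
      then have "(\<lambda>n. ?S * ennreal (s n powr - p)) \<longlonglongrightarrow> ?S * ennreal 0"
        using elim(2) by (intro ennreal_tendsto_cmult) simp_all
      then have "(\<lambda>n. ?S * ennreal (s n powr - p)) \<longlonglongrightarrow> 0" by simp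
      moreover have "\<forall>\<^sub>F n in sequentially. v n \<omega> \<le> ?S * ennreal (s n powr - p)"
        using s[unfolded filterlim_at_top_dense, rule_format, of 0]
      proof eventually_elim
        case (elim n)
        then have "v n \<omega> \<le> ennreal (\<psi> n \<omega>) * (ennreal (s n powr - p) * nn_cond_exp M F (\<lambda>\<omega>. enn_powr (X n \<omega>) p) \<omega>)"
          unfolding v_def using \<open>\<forall>n. 0 < s n \<longrightarrow> _ n\<close> by (intro mult_left_mono) auto
        also have "\<dots> = (nn_cond_exp M F (\<lambda>\<omega>. enn_powr (X n \<omega>) p) \<omega> * ennreal (\<psi> n \<omega>)) * ennreal (s n powr - p)"
          by (simp add: ac_simps)
        also have "\<dots> \<le> ?S * ennreal (s n powr - p)"
          by (intro mult_right_mono SUP_upper) auto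
        finally show ?case .
      qed
      ultimately show ?case
        by (intro tendsto_sandwich[where f="\<lambda>_. 0" and g="\<lambda>n. v n \<omega>"]) auto
    qed
  qed
  have "(\<lambda>n. \<integral>\<^sup>+\<omega>. v n \<omega> \<partial>M) \<longlonglongrightarrow> (\<integral>\<^sup>+\<omega>. 0 \<partial>M)"
    by (rule nn_integral_dominated_convergence[where w="\<lambda>_. 1"])
      (use le1 lim0 emeasure_finite[of "space M"] in \<open>auto simp: less_top[symmetric]\<close>)
  then have vlim: "(\<lambda>n. 2 * (\<integral>\<^sup>+\<omega>. v n \<omega> \<partial>M)) \<longlonglongrightarrow> 2 * 0"
    by (intro ennreal_tendsto_cmult) auto
  have Blim: "(\<lambda>n. emeasure M (B n)) \<longlonglongrightarrow> 0"
    using tendsto_ennrealI[OF \<psi>lim] by (simp add: B_def emeasure_eq_measure)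
  have bound: "emeasure M (A n) \<le> 2 * (\<integral>\<^sup>+\<omega>. v n \<omega> \<partial>M) + emeasure M (B n)" for n
  proof -
    have pt: "indicator (A n) \<omega> \<le> 2 * (ennreal (\<psi> n \<omega>) * indicator (A n) \<omega>) + (indicator (B n) \<omega> :: ennreal)"
      if "\<omega> \<in> space M" for \<omega>
    proof (cases "\<omega> \<in> A n \<and> \<omega> \<notin> B n")
      case True
      then have "1 / 2 \<le> \<psi> n \<omega>" using that by (auto simp: B_def abs_if split: if_splits)
      then have "ennreal 1 \<le> ennreal (2 * \<psi> n \<omega>)" by (intro ennreal_leI) auto
      then show ?thesis using True by (simp add: ennreal_mult')
    qed (auto simp: indicator_def add_increasing)
    have "emeasure M (A n) = (\<integral>\<^sup>+\<omega>. indicator (A n) \<omega> \<partial>M)" by simp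
    also have "\<dots> \<le> (\<integral>\<^sup>+\<omega>. 2 * (ennreal (\<psi> n \<omega>) * indicator (A n) \<omega>) + indicator (B n) \<omega> \<partial>M)"
      using pt by (intro nn_integral_mono) auto
    also have "\<dots> = 2 * (\<integral>\<^sup>+\<omega>. v n \<omega> \<partial>M) + emeasure M (B n)"
      by (simp add: nn_integral_add nn_integral_cmult int)
    finally show ?thesis .
  qed
  have "(\<lambda>n. 2 * (\<integral>\<^sup>+\<omega>. v n \<omega> \<partial>M) + emeasure M (B n)) \<longlonglongrightarrow> 0"
    using tendsto_add[OF vlim Blim] by simp
  then have "(\<lambda>n. emeasure M (A n)) \<longlonglongrightarrow> 0"
    by (rule tendsto_sandwich[where f="\<lambda>_. 0" and g="\<lambda>n. emeasure M (A n)", rotated 3])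
      (use bound in auto)
  then have "(\<lambda>n. ennreal (measure M (A n))) \<longlonglongrightarrow> ennreal 0" by (simp add: emeasure_eq_measure)
  then show ?thesis unfolding A_def by (subst (asm) tendsto_ennreal_iff) auto
qed

lemma filterlim_powr_at_top:
  fixes f :: "'b \<Rightarrow> real"
  assumes p: "0 < p" and f: "filterlim f at_top F"
  shows "filterlim (\<lambda>x. f x powr p) at_top F"
proof -
  have "((\<lambda>x. f x powr - p) \<longlongrightarrow> 0) F" using p f by (intro tendsto_neg_powr) auto
  moreover have "\<forall>\<^sub>F x in F. 0 < f x powr - p"
    using f[unfolded filterlim_at_top_dense, rule_format, of 0] by eventually_elim simp
  ultimately show ?thesis using filterlim_inverse_at_top by (force simp: powr_minus)
qed

lemma index_seqs_filterlim:
  assumes "\<tau> \<in> index_seqs TT T0"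
  shows "filterlim \<tau> (to_infty TT) sequentially"
  using assms unfolding to_infty_def index_seqs_def
  by (auto simp: filterlim_inf filterlim_principal)

text \<open>
A function that does not converge along the index set stays away from the limit on some sequence
of indices beyond \<open>T0\<close> tending to infinity.
\<close>

lemma tendsto_to_infty_sequentially:
  fixes g :: "real \<Rightarrow> 'b::metric_space"
  assumes "\<And>\<tau>. \<tau> \<in> index_seqs TT T0 \<Longrightarrow> (\<lambda>n. g (\<tau> n)) \<longlonglongrightarrow> l"
  shows "(g \<longlongrightarrow> l) (to_infty TT)"
proof (rule ccontr)
  assume "\<not> (g \<longlongrightarrow> l) (to_infty TT)"
  then obtain e where e: "e > 0" "\<not> (\<forall>\<^sub>F T in to_infty TT. dist (g T) l < e)"
    unfolding tendsto_iff by blast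
  then have "\<exists>T\<ge>N. T \<in> TT \<and> e \<le> dist (g T) l" for N
    unfolding to_infty_def eventually_inf_principal eventually_at_top_linorder by force
  then obtain t where t: "\<And>N. N \<le> t N \<and> t N \<in> TT \<and> e \<le> dist (g (t N)) l" by metis
  define \<tau> where "\<tau> n = t (max T0 (real n))" for n :: nat
  have ge: "max T0 (real n) \<le> \<tau> n" for n using t by (simp add: \<tau>_def)
  have "filterlim \<tau> at_top sequentially"
    by (rule filterlim_at_top_mono[OF filterlim_real_sequentially]) (use ge in auto)
  moreover have "T0 \<le> \<tau> n \<and> \<tau> n \<in> TT" for n
    using ge[of n] t[of "max T0 (real n)"] by (simp add: \<tau>_def)
  ultimately have "\<tau> \<in> index_seqs TT T0" by (simp add: index_seqs_def)
  then have "(\<lambda>n. g (\<tau> n)) \<longlonglongrightarrow> l" by (rule assms)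
  then obtain n where "dist (g (\<tau> n)) l < e"
    using e(1) by (metis (mono_tags, lifting) eventually_happens tendstoD trivial_limit_sequentially)
  then show False using t[of "max T0 (real n)"] by (simp add: \<tau>_def)
qed

section \<open>Polynomial large deviation inequality and local asymptotic quadraticity\<close>

theorem theorem3p1:
  fixes M \<C> :: "'a measure"
    and TT :: "real set"
    and \<Theta> :: "(real^'n) set" and \<theta>s :: "real^'n"
    and H :: "real \<Rightarrow> 'a \<Rightarrow> real^'n \<Rightarrow> real"
    and a :: "real \<Rightarrow> real^'n^'n"
    and \<Psi> :: "real \<Rightarrow> 'a \<Rightarrow> real"
    and Y :: "'a \<Rightarrow> real^'n \<Rightarrow> real"
    and \<Gamma> :: "'a \<Rightarrow> real^'n^'n"
    and \<chi>0 :: "'a \<Rightarrow> real"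
    and C1 T0 L \<alpha> \<beta> \<rho> \<beta>1 \<beta>2 \<rho>1 \<rho>2 M1 M2 M3 M4 :: real
  assumes "prob_space M" and "subalgebra M \<C>"
    and "TT \<subseteq> {0..}" and "\<not> bdd_above TT"
    and "open \<Theta>" and "connected \<Theta>" and "bounded \<Theta>" and "\<theta>s \<in> \<Theta>"
    and "\<forall>T\<in>TT. (\<lambda>(\<omega>, \<theta>). H T \<omega> \<theta>) \<in> borel_measurable (M \<Otimes>\<^sub>M restrict_space borel (closure \<Theta>))"
    and "\<forall>T\<in>TT. \<forall>\<omega>\<in>space M. continuous_on (closure \<Theta>) (H T \<omega>)"
    and "\<forall>T\<in>TT. \<forall>\<omega>\<in>space M. Ck_on 3 \<Theta> (H T \<omega>)"
    and "\<forall>T\<in>TT. invertible (a T)"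
    and "(a \<longlongrightarrow> 0) (to_infty TT)"
    and "1 \<le> C1"
    and "\<forall>T\<in>TT. inverse (brate a T) \<le> lambda_max (transpose (a T) ** a T)
           \<and> lambda_max (transpose (a T) ** a T) \<le> C1 * inverse (brate a T)"
    and "\<forall>T\<in>TT. \<Psi> T \<in> borel_measurable \<C> \<and> (\<forall>\<omega>\<in>space M. \<Psi> T \<omega> \<in> {0..1})"
    and "0 < T0"
    and "(\<lambda>(\<omega>, \<theta>). Y \<omega> \<theta>) \<in> borel_measurable (M \<Otimes>\<^sub>M restrict_space borel \<Theta>)"
    and "\<Gamma> \<in> borel_measurable M" and "\<forall>\<omega>\<in>space M. pos_definite (\<Gamma> \<omega>)"
    and "0 < L" and "0 < \<alpha>" and "\<alpha> < 1" and "\<beta> = \<alpha> / (1 - \<alpha>)" and "0 < \<rho>"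
    \<comment> \<open>(1)\<close>
    and "0 < \<beta>1" and "\<beta>1 < 1/2"
    and "0 < \<rho>1" and "\<rho>1 < Min {1, \<beta>, 2 * \<beta>1 / (1 - \<alpha>)}"
    and "\<alpha> * \<rho> < \<rho>2" and "0 \<le> \<beta>2" and "0 < 1 - 2 * \<beta>2 - \<rho>2"
    \<comment> \<open>(2)\<close>
    and "\<chi>0 \<in> borel_measurable M" and "\<forall>\<omega>\<in>space M. 0 < \<chi>0 \<omega>"
    and "AE \<omega> in M. \<forall>\<theta>\<in>\<Theta>. Y \<omega> \<theta> = Y \<omega> \<theta> - Y \<omega> \<theta>s
           \<and> Y \<omega> \<theta> - Y \<omega> \<theta>s \<le> - \<chi>0 \<omega> * norm (\<theta> - \<theta>s) powr \<rho>"
    and "AE \<omega> in M. (SUP r\<in>{1::nat..}. ennreal (real r powr L)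
           * cprob M \<C> (\<lambda>\<omega>. \<chi>0 \<omega> \<le> real r powr (- (\<rho>2 - \<alpha> * \<rho>))) \<omega>) < \<infinity>"
    \<comment> \<open>(3)\<close>
    and "AE \<omega> in M. (SUP r\<in>{1::nat..}. ennreal (real r powr L)
           * cprob M \<C> (\<lambda>\<omega>. lambda_min (\<Gamma> \<omega>) < 4 * real r powr (- \<rho>1)) \<omega>) < \<infinity>"
    \<comment> \<open>(4)\<close>
    and "M1 = L / (1 - \<rho>1)" and "M2 = L / (1 - 2 * \<beta>2 - \<rho>2)"
    and "\<forall>\<tau>\<in>index_seqs TT T0. AE \<omega> in M. (SUP n.
           nn_cond_exp M \<C> (\<lambda>\<omega>. ennreal (norm (DeltaT H a \<theta>s (\<tau> n) \<omega>) powr M1)) \<omega>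
           * ennreal (\<Psi> (\<tau> n) \<omega>)) < \<infinity>"
    and "\<forall>\<tau>\<in>index_seqs TT T0. AE \<omega> in M. (SUP n.
           nn_cond_exp M \<C> (meas_cover M (\<lambda>\<omega>. enn_powr (SUP \<theta>\<in>\<Theta>.
             ennreal (brate a (\<tau> n) powr (1/2 - \<beta>2) * \<bar>YT H a \<theta>s (\<tau> n) \<omega> \<theta> - Y \<omega> \<theta>\<bar>)) M2)) \<omega>
           * ennreal (\<Psi> (\<tau> n) \<omega>)) < \<infinity>"
    \<comment> \<open>(5)\<close>
    and "M3 = L / (\<beta> - \<rho>1)" and "M4 = L / (2 * \<beta>1 / (1 - \<alpha>) - \<rho>1)"
    and "\<forall>\<tau>\<in>index_seqs TT T0. AE \<omega> in M. (SUP n.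
           nn_cond_exp M \<C> (\<lambda>\<omega>. enn_powr (ennreal (inverse (brate a (\<tau> n)))
             * (SUP \<theta>\<in>\<Theta>. ennreal (norm (D3 (H (\<tau> n) \<omega>) \<theta>)))) M3) \<omega>
           * ennreal (\<Psi> (\<tau> n) \<omega>)) < \<infinity>"
    and "\<forall>\<tau>\<in>index_seqs TT T0. AE \<omega> in M. (SUP n.
           nn_cond_exp M \<C> (\<lambda>\<omega>. ennreal ((brate a (\<tau> n) powr \<beta>1
             * norm (GammaT H a \<theta>s (\<tau> n) \<omega> - \<Gamma> \<omega>)) powr M4)) \<omega>
           * ennreal (\<Psi> (\<tau> n) \<omega>)) < \<infinity>"
  shows "(\<forall>\<tau>\<in>index_seqs TT T0. AE \<omega> in M. (SUP n. SUP r\<in>{1::nat..}.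
            ennreal (real r powr L)
            * cprob M \<C> (\<lambda>\<omega>. ennreal (exp (- (1/2) * real r powr (2 - max \<rho>1 \<rho>2)))
                \<le> (SUP u\<in>VV \<Theta> a \<theta>s (\<tau> n) (real r). ennreal (ZZ H a \<theta>s (\<tau> n) \<omega> u))) \<omega>
            * ennreal (\<Psi> (\<tau> n) \<omega>)) < \<infinity>)
       \<and> (conv_in_prob M \<Psi> 1 (to_infty TT) \<longrightarrow>
          (\<exists>R :: real \<Rightarrow> real^'n \<Rightarrow> 'a \<Rightarrow> real.
             (\<forall>T\<in>TT. \<forall>u. R T u \<in> borel_measurable M)
           \<and> (\<forall>T\<in>TT. \<forall>u\<in>UU \<Theta> a \<theta>s T. \<forall>\<omega>\<in>space M.
                ZZ H a \<theta>s T \<omega> u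
                = exp (DeltaT H a \<theta>s T \<omega> \<bullet> u - 1/2 * (u \<bullet> (\<Gamma> \<omega> *v u)) + R T u \<omega>))
           \<and> (\<forall>u. conv_in_prob M (\<lambda>T. R T u) 0 (to_infty TT))))"
proof -
  interpret prob_space M by fact
  interpret finite_measure_subalgebra M \<C> by standard fact
  note H_joint = assms(9) and H_C3 = assms(11) and a_inv = assms(12) and a_lim = assms(13)
    and eig_ratio = assms(15) and Psi_range = assms(16) and Gamma_rv = assms(19) and Gamma_pd = assms(20)
    and separation = assms(35) and chi_tail = assms(36) and Gamma_tail = assms(37)
    and M1_eq = assms(38) and M2_eq = assms(39) and Delta_moment = assms(40) and YT_moment = assms(41)
    and M3_eq = assms(42) and M4_eq = assms(43) and D3_moment = assms(44) and GammaT_moment = assms(45)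
  note open\<Theta> = \<open>open \<Theta>\<close> and \<theta>s = \<open>\<theta>s \<in> \<Theta>\<close>
  have C1: "1 \<le> C1" by fact
  have par: "0 < \<alpha>" "\<alpha> < 1" "\<beta> = \<alpha> / (1 - \<alpha>)" "0 < \<beta>1" "0 < \<rho>" "\<alpha> * \<rho> < \<rho>2" "0 \<le> \<beta>2"
    "0 < 1 - 2 * \<beta>2 - \<rho>2" and L: "0 < L" by fact+
  have \<rho>1: "\<rho>1 < 1" "\<rho>1 < \<beta>" "\<rho>1 < 2 * \<beta>1 / (1 - \<alpha>)"
    using \<open>\<rho>1 < Min {1, \<beta>, 2 * \<beta>1 / (1 - \<alpha>)}\<close> by auto
  have M34: "0 < M3" "0 < M4" using L \<rho>1 by (auto simp: M3_eq M4_eq)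
  have b: "0 < brate a T" "(norm u)\<^sup>2 \<le> brate a T * (norm (a T *v u))\<^sup>2"
    "(norm (a T *v u))\<^sup>2 \<le> C1 / brate a T * (norm u)\<^sup>2" if "T \<in> TT" for T u
    using normalizing_matrix_bounds[of a T C1] a_inv eig_ratio that by auto
  have C3: "Ck_on 3 \<Theta> (H T \<omega>)" if "T \<in> TT" "\<omega> \<in> space M" for T \<omega>
    using H_C3 that by blast
  have \<Gamma>sym: "transpose (\<Gamma> \<omega>) = \<Gamma> \<omega>" if "\<omega> \<in> space M" for \<omega>
    using Gamma_pd that by (auto simp: pos_definite_def)
  obtain \<delta> where \<delta>: "0 < \<delta>" "ball \<theta>s \<delta> \<subseteq> \<Theta>" using open\<Theta> \<theta>s openE by blast
  obtain D0 where D0: "\<And>\<theta>. \<theta> \<in> \<Theta> \<Longrightarrow> dist \<theta>s \<theta> \<le> D0"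
    using \<open>bounded \<Theta>\<close> bounded_any_center[of \<Theta> \<theta>s] by auto
  define D where "D = max D0 1"
  have D: "0 < D" "norm (\<theta> - \<theta>s) \<le> D" if "\<theta> \<in> \<Theta>" for \<theta>
    using D0[OF that] by (auto simp: D_def dist_norm norm_minus_commute)
  have D_pos: "0 < D" using D(1)[OF \<theta>s] .

  note [measurable] = Gamma_rv \<open>\<chi>0 \<in> borel_measurable M\<close>
  have H_meas: "(\<lambda>\<omega>. H T \<omega> y) \<in> borel_measurable M" if "T \<in> TT" "y \<in> \<Theta>" for T y
  proof -
    have "(\<lambda>\<omega>. (\<omega>, y)) \<in> M \<rightarrow>\<^sub>M M \<Otimes>\<^sub>M restrict_space borel (closure \<Theta>)"
      using that(2) closure_subset[of \<Theta>] by (intro measurable_Pair2') (auto simp: space_restrict_space)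
    from measurable_compose[OF this H_joint[rule_format, OF that(1)]] show ?thesis by simp
  qed
  note arrays = borel_measurable_derivative_arrays[where M=M, OF open\<Theta> \<theta>s C3 H_meas]
  have Delta_meas [measurable]: "(\<lambda>\<omega>. DeltaT H a \<theta>s T \<omega>) \<in> borel_measurable M" if "T \<in> TT" for T
    unfolding DeltaT_def using arrays(1)[of T] that by (intro borel_measurable_matrix_const_mult) auto
  have Gamma_meas [measurable]: "(\<lambda>\<omega>. GammaT H a \<theta>s T \<omega>) \<in> borel_measurable M" if "T \<in> TT" for T
    unfolding GammaT_def using arrays(2)[of T] that
    by (intro borel_measurable_uminus borel_measurable_matrix_sandwich) auto
  define X3 where "X3 T \<omega> = ennreal (inverse (brate a T)) * (SUP \<theta>\<in>\<Theta>. ennreal (norm (D3 (H T \<omega>) \<theta>)))" for T \<omega>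
  define X4 where "X4 T \<omega> = ennreal (brate a T powr \<beta>1 * norm (GammaT H a \<theta>s T \<omega> - \<Gamma> \<omega>))" for T \<omega>
  have X3_meas [measurable]: "X3 T \<in> borel_measurable M" if "T \<in> TT" for T
    unfolding X3_def[abs_def]
    using borel_measurable_SUP_norm_D3[where M=M and F="H T", OF open\<Theta> C3 H_meas] that by measurable
  have X4_meas [measurable]: "X4 T \<in> borel_measurable M" if "T \<in> TT" for T
    unfolding X4_def[abs_def] using Gamma_meas[OF that] by measurable
  have X3_le: "inverse (brate a T) * norm (D3 (H T \<omega>) \<theta>) \<le> x"
    if "T \<in> TT" "X3 T \<omega> < ennreal x" "\<theta> \<in> \<Theta>" "0 \<le> x" for T \<omega> \<theta> x
  proof -
    have "ennreal (inverse (brate a T) * norm (D3 (H T \<omega>) \<theta>)) \<le> X3 T \<omega>"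
      unfolding X3_def using b(1)[OF that(1)] that(3)
      by (subst ennreal_mult) (auto intro!: mult_left_mono SUP_upper)
    then have "ennreal (inverse (brate a T) * norm (D3 (H T \<omega>) \<theta>)) < ennreal x" using that(2) by simp
    then show ?thesis by (subst (asm) ennreal_less_iff) (use b(1)[OF that(1)] in auto)
  qed
  have X3_fin: "AE \<omega> in M. (SUP n. nn_cond_exp M \<C> (\<lambda>\<omega>. enn_powr (X3 (\<tau> n) \<omega>) M3) \<omega> * ennreal (\<Psi> (\<tau> n) \<omega>)) < \<infinity>"
    if "\<tau> \<in> index_seqs TT T0" for \<tau>
    using D3_moment that by (simp add: X3_def)
  have X4_fin: "AE \<omega> in M. (SUP n. nn_cond_exp M \<C> (\<lambda>\<omega>. enn_powr (X4 (\<tau> n) \<omega>) M4) \<omega> * ennreal (\<Psi> (\<tau> n) \<omega>)) < \<infinity>"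
    if "\<tau> \<in> index_seqs TT T0" for \<tau>
    using GammaT_moment that by (simp add: X4_def enn_powr_ennreal)
  have in_TT: "\<tau> n \<in> TT" if "\<tau> \<in> index_seqs TT T0" for \<tau> n
    using that by (auto simp: index_seqs_def)

  have tail: "AE \<omega> in M. (SUP n. SUP r\<in>{1::nat..}. ennreal (real r powr L)
            * cprob M \<C> (\<lambda>\<omega>. ennreal (exp (- (1/2) * real r powr (2 - max \<rho>1 \<rho>2)))
                \<le> (SUP u\<in>VV \<Theta> a \<theta>s (\<tau> n) (real r). ennreal (ZZ H a \<theta>s (\<tau> n) \<omega> u))) \<omega>
            * ennreal (\<Psi> (\<tau> n) \<omega>)) < \<infinity>" if \<tau>: "\<tau> \<in> index_seqs TT T0" for \<tau>
  proof -
    have T: "\<tau> n \<in> TT" for n using in_TT[OF \<tau>] .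
    have \<psi>1: "ennreal (\<Psi> (\<tau> n) \<omega>) \<le> 1" if "\<omega> \<in> space M" for n \<omega>
      using Psi_range T that by (auto simp: ennreal_le_1)
    \<comment> \<open>For \<open>r \<le> R0\<close> the trivial bound \<open>1\<close> suffices; beyond \<open>R0\<close> the inner regime lies in the ball
      of radius \<open>\<delta>\<close>. The constants \<open>K\<close>, \<open>c2\<close> and \<open>c3\<close> are those required by the pointwise bound on
      the log likelihood ratio.\<close>
    define R0 where "R0 = D * (sqrt C1 / \<delta>) powr (1 / \<alpha>)"
    define K where "K = 2 * D powr (2 - \<alpha> * \<rho>)"
    define X1 where "X1 T \<omega> = ennreal (norm (DeltaT H a \<theta>s T \<omega>))" for T \<omega>
    define X2 where "X2 T \<omega> = (SUP \<theta>\<in>\<Theta>. ennreal (brate a T powr (1/2 - \<beta>2) * \<bar>YT H a \<theta>s T \<omega> \<theta> - Y \<omega> \<theta>\<bar>))" for T \<omega>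
    define G2 where "G2 T = meas_cover M (\<lambda>\<omega>. enn_powr (X2 T \<omega>) M2)" for T
    define c2 where "c2 = D powr (1 + 2 * \<beta>2)"
    define c3 where "c3 = 3 / (2 * sqrt C1 ^ 3)"
    have c: "0 < c2" "0 < c3" using D_pos C1 by (auto simp: c2_def c3_def)
    define E\<chi> where "E\<chi> r = {\<omega> \<in> space M. \<chi>0 \<omega> \<le> K * real r powr - (\<rho>2 - \<alpha> * \<rho>)}" for r :: nat
    define E\<Gamma> where "E\<Gamma> r = {\<omega> \<in> space M. lambda_min (\<Gamma> \<omega>) < 4 * real r powr - \<rho>1}" for r :: nat
    have [measurable]: "E\<chi> r \<in> sets M" "E\<Gamma> r \<in> sets M" for r
      unfolding E\<chi>_def E\<Gamma>_def using lambda_min_less_measurable[OF Gamma_rv \<Gamma>sym] by auto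
    have cover: "G2 T \<in> borel_measurable M" "\<And>\<omega>. \<omega> \<in> space M \<Longrightarrow> enn_powr (X2 T \<omega>) M2 \<le> G2 T \<omega>" for T
      using meas_cover[OF finite_measure_axioms, of "\<lambda>\<omega>. enn_powr (X2 T \<omega>) M2"]
      by (auto simp: G2_def is_meas_cover_def)
    \<comment> \<open>One summand for small \<open>r\<close> and one for each way in which the pointwise bound can fail.\<close>
    define f where "f n r \<omega> = ennreal (R0 powr L * real r powr - L) * 1
        + indicator (E\<chi> r) \<omega> + indicator (E\<Gamma> r) \<omega>
        + ennreal ((1/4) powr - M1 * real r powr - L) * enn_powr (X1 (\<tau> n) \<omega>) M1
        + ennreal (c2 powr - M2 * real r powr - L) * G2 (\<tau> n) \<omega>
        + ennreal (c3 powr - M3 * real r powr - L) * enn_powr (X3 (\<tau> n) \<omega>) M3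
        + ennreal ((1/2) powr - M4 * real r powr - L) * enn_powr (X4 (\<tau> n) \<omega>) M4"
      for n r \<omega>
    let ?ctb = "cond_tail_bounded M \<C> (\<lambda>n \<omega>. ennreal (\<Psi> (\<tau> n) \<omega>)) L"
    have "?ctb (\<lambda>n r \<omega>. ennreal (R0 powr L * real r powr - L) * 1)"
    proof (rule cond_tail_bounded_power)
      have "AE \<omega> in M. nn_cond_exp M \<C> (\<lambda>_. 1) \<omega> \<le> 1" by (rule nn_cond_exp_le_1) auto
      then show "AE \<omega> in M. (SUP n. nn_cond_exp M \<C> (\<lambda>_. 1) \<omega> * ennreal (\<Psi> (\<tau> n) \<omega>)) < \<infinity>"
        using AE_space
      proof eventually_elim
        case (elim \<omega>)
        then have "(SUP n. nn_cond_exp M \<C> (\<lambda>_. 1) \<omega> * ennreal (\<Psi> (\<tau> n) \<omega>)) \<le> 1 * 1"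
          using \<psi>1 by (intro SUP_least mult_mono) auto
        also have "\<dots> < \<infinity>" by simp
        finally show ?case .
      qed
    qed simp
    moreover have "?ctb (\<lambda>n r. indicator (E\<chi> r))"
    proof (rule cond_tail_bounded_time_independent)
      define \<gamma> where "\<gamma> = \<rho>2 - \<alpha> * \<rho>"
      have \<gamma>: "0 < \<gamma>" using par by (simp add: \<gamma>_def)
      have K: "0 < K" using D_pos by (simp add: K_def)
      \<comment> \<open>The tail hypothesis on \<open>\<chi>0\<close> has constant \<open>1\<close> instead of \<open>K\<close>; dilating \<open>r\<close> by \<open>k\<close> makes up for it.\<close>
      obtain k0 :: nat where k0: "K powr (1 / \<gamma>) \<le> real k0" using real_arch_simple by blast
      define k where "k = Suc k0"
      have "K = (K powr (1 / \<gamma>)) powr \<gamma>" using K \<gamma> by (simp add: powr_powr)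
      also have "\<dots> \<le> real k powr \<gamma>" using k0 \<gamma> by (intro powr_mono2) (auto simp: k_def)
      finally have Kk: "K \<le> real k powr \<gamma>" .
      show "AE \<omega> in M. (SUP r\<in>{1..}. ennreal (real r powr L) * nn_cond_exp M \<C> (indicator (E\<chi> r)) \<omega>) < \<infinity>"
      proof (rule cond_tail_rescale[where k=k])
        let ?g = "\<lambda>r::nat. indicator {\<omega> \<in> space M. \<chi>0 \<omega> \<le> real r powr - (\<rho>2 - \<alpha> * \<rho>)} :: 'a \<Rightarrow> ennreal"
        show "AE \<omega> in M. (SUP r\<in>{1..}. ennreal (real r powr L) * nn_cond_exp M \<C> (?g r) \<omega>) < \<infinity>"
          using chi_tail by (simp add: cprob_def)
        fix r \<omega> assume r: "k \<le> r"
        then have q: "1 \<le> r div k" by (simp add: k_def Suc_le_eq div_greater_zero_iff)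
        have "K * real r powr - \<gamma> \<le> real k powr \<gamma> * real r powr - \<gamma>" using Kk by (intro mult_right_mono) auto
        also have "\<dots> = (real r / real k) powr - \<gamma>" by (simp add: powr_divide powr_minus field_simps)
        also have "\<dots> \<le> real (r div k) powr - \<gamma>"
          using q \<gamma> by (intro powr_mono2') (auto simp: of_nat_div_le_of_nat)
        finally show "indicator (E\<chi> r) \<omega> \<le> ?g (r div k) \<omega>"
          by (auto simp: E\<chi>_def \<gamma>_def indicator_def)
      qed (auto simp: k_def L indicator_def)
    qed (use \<psi>1 in simp_all)
    moreover have "?ctb (\<lambda>n r. indicator (E\<Gamma> r))"
    proof (rule cond_tail_bounded_time_independent[OF _ \<psi>1])
      show "AE \<omega> in M. (SUP r\<in>{1..}. ennreal (real r powr L) * nn_cond_exp M \<C> (indicator (E\<Gamma> r)) \<omega>) < \<infinity>"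
        using Gamma_tail unfolding cprob_def E\<Gamma>_def .
    qed simp_all
    moreover have "?ctb (\<lambda>n r \<omega>. ennreal ((1/4) powr - M1 * real r powr - L) * enn_powr (X1 (\<tau> n) \<omega>) M1)"
    proof (rule cond_tail_bounded_power)
      show "(\<lambda>\<omega>. enn_powr (X1 (\<tau> n) \<omega>) M1) \<in> borel_measurable M" for n
        unfolding X1_def using Delta_meas[OF T] by measurable
      show "AE \<omega> in M. (SUP n. nn_cond_exp M \<C> (\<lambda>\<omega>. enn_powr (X1 (\<tau> n) \<omega>) M1) \<omega> * ennreal (\<Psi> (\<tau> n) \<omega>)) < \<infinity>"
        unfolding X1_def enn_powr_ennreal[OF norm_ge_zero] by (rule Delta_moment[rule_format, OF \<tau>])
    qed
    moreover have "?ctb (\<lambda>n r \<omega>. ennreal (c2 powr - M2 * real r powr - L) * G2 (\<tau> n) \<omega>)"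
      using YT_moment[rule_format, OF \<tau>] cover(1)
      by (intro cond_tail_bounded_power) (simp_all only: G2_def X2_def)
    moreover have "?ctb (\<lambda>n r \<omega>. ennreal (c3 powr - M3 * real r powr - L) * enn_powr (X3 (\<tau> n) \<omega>) M3)"
      by (intro cond_tail_bounded_power X3_fin[OF \<tau>] borel_measurable_enn_powr X3_meas[OF T])
    moreover have "?ctb (\<lambda>n r \<omega>. ennreal ((1/2) powr - M4 * real r powr - L) * enn_powr (X4 (\<tau> n) \<omega>) M4)"
      by (intro cond_tail_bounded_power X4_fin[OF \<tau>] borel_measurable_enn_powr X4_meas[OF T])
    ultimately have f: "?ctb f" unfolding f_def[abs_def] by (intro cond_tail_bounded_add)
    show ?thesis unfolding cprob_def
    proof (rule cond_tail_bounded_dominate[OF f])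
      fix n r :: nat assume r: "1 \<le> r"
      let ?T = "\<tau> n" and ?e = "real r powr (2 - max \<rho>1 \<rho>2)"
      let ?A = "{\<omega> \<in> space M. ennreal (exp (- (1/2) * ?e)) \<le> (SUP u\<in>VV \<Theta> a \<theta>s ?T (real r). ennreal (ZZ H a \<theta>s ?T \<omega> u))}"
      show "AE \<omega> in M. indicator ?A \<omega> \<le> f n r \<omega>"
        using separation AE_space
      proof eventually_elim
        case (elim \<omega>)
        have "1 \<le> f n r \<omega>" if \<omega>: "\<omega> \<in> ?A"
        proof (rule ccontr)
          assume "\<not> 1 \<le> f n r \<omega>"
          then have "f n r \<omega> < 1" by simp
          \<comment> \<open>Every summand of \<open>f\<close> is below \<open>1\<close>, so none of the exceptional events occurs at \<open>\<omega>\<close>.\<close>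
          note sum6 = this[unfolded f_def]
          note sum5 = add_less_oneD(1)[OF sum6]
          note sum4 = add_less_oneD(1)[OF sum5]
          note sum3 = add_less_oneD(1)[OF sum4]
          note sum2 = add_less_oneD(1)[OF sum3]
          note small = add_less_oneD(1)[OF add_less_oneD(1)[OF sum2]] add_less_oneD(2)[OF add_less_oneD(1)[OF sum2]]
            add_less_oneD(2)[OF sum2] add_less_oneD(2)[OF sum3] add_less_oneD(2)[OF sum4]
            add_less_oneD(2)[OF sum5] add_less_oneD(2)[OF sum6]
          have r0: "0 < real r" using r by simp
          have "R0 < real r"
          proof (rule ccontr)
            assume "\<not> R0 < real r"
            then have "real r powr L \<le> R0 powr L" using r0 L by (intro powr_mono2) auto
            then have "1 \<le> R0 powr L * real r powr - L" using r0 by (simp add: powr_minus field_simps)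
            then have "1 \<le> ennreal (R0 powr L * real r powr - L)" using ennreal_leI[of 1] by force
            then show False using small(1) by simp
          qed
          then have "(sqrt C1 / \<delta>) powr (1 / \<alpha>) < real r / D" using D_pos by (simp add: R0_def field_simps)
          then have "((sqrt C1 / \<delta>) powr (1 / \<alpha>)) powr \<alpha> < (real r / D) powr \<alpha>"
            using par by (intro powr_less_mono2) auto
          then have large: "sqrt C1 * (real r / D) powr - \<alpha> < \<delta>"
            using par C1 \<delta> r0 D_pos by (simp add: powr_powr powr_minus field_simps)
          have g\<chi>: "2 * D powr (2 - \<alpha> * \<rho>) * real r powr - (\<rho>2 - \<alpha> * \<rho>) \<le> \<chi>0 \<omega>"
          proof -
            have "\<omega> \<notin> E\<chi> r" using small(2) by (cases "\<omega> \<in> E\<chi> r") auto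
            then show ?thesis using elim(2) by (simp add: E\<chi>_def K_def)
          qed
          have g\<Gamma>: "4 * real r powr - \<rho>1 \<le> lambda_min (\<Gamma> \<omega>)"
          proof -
            have "\<omega> \<notin> E\<Gamma> r" using small(3) by (cases "\<omega> \<in> E\<Gamma> r") auto
            then show ?thesis using elim(2) by (simp add: E\<Gamma>_def)
          qed
          have "\<not> ennreal (1/4 * real r powr (1 - \<rho>1)) \<le> X1 ?T \<omega>"
            using leD[OF markov_enn_powr_tail[OF _ r0 _ L M1_eq]] small(4) \<rho>1 by auto
          then have g1: "norm (DeltaT H a \<theta>s ?T \<omega>) \<le> 1/4 * real r powr (1 - \<rho>1)"
            by (auto simp: X1_def not_le intro: less_imp_le)
          have "\<not> ennreal (c2 * real r powr (1 - 2 * \<beta>2 - \<rho>2)) \<le> X2 ?T \<omega>"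
          proof
            assume "ennreal (c2 * real r powr (1 - 2 * \<beta>2 - \<rho>2)) \<le> X2 ?T \<omega>"
            then have "1 \<le> ennreal (c2 powr - M2 * real r powr - L) * enn_powr (X2 ?T \<omega>) M2"
              by (rule markov_enn_powr_tail[OF c(1) r0 par(8) L M2_eq])
            also have "\<dots> \<le> ennreal (c2 powr - M2 * real r powr - L) * G2 ?T \<omega>"
              by (rule mult_left_mono[OF cover(2)[OF elim(2)]]) simp
            finally show False using small(5) by simp
          qed
          then have g2: "brate a ?T powr (1/2 - \<beta>2) * \<bar>YT H a \<theta>s ?T \<omega> \<theta> - Y \<omega> \<theta>\<bar>
              \<le> D powr (1 + 2 * \<beta>2) * real r powr (1 - 2 * \<beta>2 - \<rho>2)" if "\<theta> \<in> \<Theta>" for \<theta>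
            unfolding X2_def c2_def not_le by (rule SUP_ennreal_less_imp_le[OF _ that])
          have "\<not> ennreal (c3 * real r powr (\<beta> - \<rho>1)) \<le> X3 ?T \<omega>"
            using leD[OF markov_enn_powr_tail[OF c(2) r0 _ L M3_eq]] small(6) \<rho>1 by auto
          then have g3: "inverse (brate a ?T) * norm (D3 (H ?T \<omega>) \<theta>) \<le> 3 / (2 * sqrt C1 ^ 3) * real r powr (\<beta> - \<rho>1)"
            if "\<theta> \<in> \<Theta>" for \<theta>
            using X3_le[OF T _ that] c(2) by (simp add: c3_def not_le)
          have "\<not> ennreal (1/2 * real r powr (2 * \<beta>1 / (1 - \<alpha>) - \<rho>1)) \<le> X4 ?T \<omega>"
            using leD[OF markov_enn_powr_tail[OF _ r0 _ L M4_eq]] small(7) \<rho>1 by auto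
          then have g4: "brate a ?T powr \<beta>1 * norm (GammaT H a \<theta>s ?T \<omega> - \<Gamma> \<omega>) \<le> 1/2 * real r powr (2 * \<beta>1 / (1 - \<alpha>) - \<rho>1)"
            by (auto simp: X4_def not_le ennreal_less_iff intro: less_imp_le)
          have Yb: "Y \<omega> \<theta> \<le> - \<chi>0 \<omega> * norm (\<theta> - \<theta>s) powr \<rho>" if "\<theta> \<in> \<Theta>" for \<theta>
            using elim(1) that by metis
          \<comment> \<open>The exponent is twice the required one, which excludes equality in the event.\<close>
          have "ZZ H a \<theta>s ?T \<omega> u \<le> exp (- ?e)" if "u \<in> VV \<Theta> a \<theta>s ?T (real r)" for u
            unfolding ZZ_def exp_le_cancel_iff
            by (rule log_likelihood_ratio_bound[where G="\<Gamma> \<omega>" and Y=Y and \<kappa>="\<chi>0 \<omega>", OF b[OF T] C1 C3[OF T elim(2)] \<delta>(2)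
                  D_pos D(2) par _ large Yb \<Gamma>sym[OF elim(2)] g\<chi> g\<Gamma> g1 g2 g3 g4 that])
              (use r in auto)
          then have "(SUP u\<in>VV \<Theta> a \<theta>s ?T (real r). ennreal (ZZ H a \<theta>s ?T \<omega> u)) \<le> ennreal (exp (- ?e))"
            by (intro SUP_least ennreal_leI)
          moreover have "ennreal (exp (- (1/2) * ?e)) \<le> (SUP u\<in>VV \<Theta> a \<theta>s ?T (real r). ennreal (ZZ H a \<theta>s ?T \<omega> u))"
            using \<omega> by blast
          ultimately have "ennreal (exp (- (1/2) * ?e)) \<le> ennreal (exp (- ?e))" by (rule order_trans[rotated])
          then have "exp (- (1/2) * ?e) \<le> exp (- ?e)" by (subst (asm) ennreal_le_iff) auto
          moreover have "0 < ?e" using r0 by simp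
          ultimately show False by simp
        qed
        then show ?case by (auto simp: indicator_def)
      qed
    qed
  qed

  \<comment> \<open>The representation dictates the remainder on the local parameter set, which contains each \<open>u\<close>
    for all large \<open>T\<close>; elsewhere the likelihood ratio has no meaning and the remainder is set to \<open>0\<close>.\<close>
  define R where "R T u \<omega> = (if u \<in> UU \<Theta> a \<theta>s T then H T \<omega> (theta_dag a \<theta>s T u) - H T \<omega> \<theta>s
      - DeltaT H a \<theta>s T \<omega> \<bullet> u + 1/2 * (u \<bullet> (\<Gamma> \<omega> *v u)) else 0)" for T u \<omega>
  have R_meas [measurable]: "R T u \<in> borel_measurable M" if "T \<in> TT" for T u
  proof (cases "u \<in> UU \<Theta> a \<theta>s T")
    case True
    have [measurable]: "(\<lambda>\<omega>. H T \<omega> (theta_dag a \<theta>s T u)) \<in> borel_measurable M" "(\<lambda>\<omega>. H T \<omega> \<theta>s) \<in> borel_measurable M"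
      using True \<theta>s by (auto simp: UU_def intro!: H_meas[OF that])
    have [measurable]: "DeltaT H a \<theta>s T \<in> borel_measurable M" using Delta_meas[OF that] by simp
    show ?thesis using True unfolding R_def[abs_def] by simp
  next
    case False
    then show ?thesis unfolding R_def[abs_def] by simp
  qed
  have R_eq: "ZZ H a \<theta>s T \<omega> u = exp (DeltaT H a \<theta>s T \<omega> \<bullet> u - 1/2 * (u \<bullet> (\<Gamma> \<omega> *v u)) + R T u \<omega>)"
    if "u \<in> UU \<Theta> a \<theta>s T" for T u \<omega>
    using that by (simp add: ZZ_def R_def)
  have R_lim: "conv_in_prob M (\<lambda>T. R T u) 0 (to_infty TT)" if \<Psi>: "conv_in_prob M \<Psi> 1 (to_infty TT)" for u
    unfolding conv_in_prob_def
  proof (intro allI impI, rule tendsto_to_infty_sequentially[where ?T0.0=T0])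
    fix \<epsilon> :: real and \<tau> assume \<epsilon>: "0 < \<epsilon>" and \<tau>: "\<tau> \<in> index_seqs TT T0"
    have T: "\<tau> n \<in> TT" for n using in_TT[OF \<tau>] .
    have a0: "(\<lambda>n. norm (a (\<tau> n))) \<longlonglongrightarrow> 0"
      using filterlim_compose[OF a_lim index_seqs_filterlim[OF \<tau>]] by (rule tendsto_norm_zero)
    \<comment> \<open>For a unit vector \<open>w\<close>, \<open>1 \<le> b\<^sub>T |a\<^sub>T w|\<^sup>2\<close>, and \<open>a\<^sub>T\<close> tends to \<open>0\<close>.\<close>
    have blim: "filterlim (\<lambda>n. brate a (\<tau> n)) at_top sequentially"
    proof -
      obtain w :: "real^'n" where w: "norm w = 1" using vector_choose_size[of 1] by auto
      have "inverse (brate a (\<tau> n)) \<le> (norm (a (\<tau> n)))\<^sup>2" for n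
      proof -
        have "1 \<le> brate a (\<tau> n) * (norm (a (\<tau> n) *v w))\<^sup>2" using b(2)[OF T, of w n] w by simp
        also have "\<dots> \<le> brate a (\<tau> n) * (norm (a (\<tau> n)))\<^sup>2"
          using norm_matrix_vector_mult_le[of "a (\<tau> n)" w] w b(1)[OF T, of n]
          by (intro mult_left_mono power_mono) auto
        finally show ?thesis using b(1)[OF T, of n] by (simp add: field_simps)
      qed
      moreover have "(\<lambda>n. (norm (a (\<tau> n)))\<^sup>2) \<longlonglongrightarrow> 0" using tendsto_power[OF a0, of 2] by simp
      ultimately have "(\<lambda>n. inverse (brate a (\<tau> n))) \<longlonglongrightarrow> 0"
        using b(1)[OF T]
        by (intro tendsto_sandwich[where f="\<lambda>_. 0" and g="\<lambda>n. inverse (brate a (\<tau> n))"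
              and h="\<lambda>n. (norm (a (\<tau> n)))\<^sup>2"] always_eventually) (simp_all add: less_imp_le)
      from filterlim_inverse_at_top[OF this] show ?thesis using b(1)[OF T] by simp
    qed
    have \<Psi>lim: "(\<lambda>n. measure M {\<omega> \<in> space M. 1 / 2 < \<bar>\<Psi> (\<tau> n) \<omega> - 1\<bar>}) \<longlonglongrightarrow> 0"
      using filterlim_compose[OF \<Psi>[unfolded conv_in_prob_def, rule_format] index_seqs_filterlim[OF \<tau>], of "1/2"] by simp
    have \<Psi>m: "\<Psi> (\<tau> n) \<in> borel_measurable \<C>" "\<omega> \<in> space M \<Longrightarrow> \<Psi> (\<tau> n) \<omega> \<le> 1" for n \<omega>
      using Psi_range T by auto
    let ?K = "sqrt C1 ^ 3 / 6"
    \<comment> \<open>Below the thresholds \<open>\<epsilon>3 b\<^sup>1\<^sup>/\<^sup>2\<close> and \<open>\<epsilon>4 b\<^sup>\<beta>\<^sup>1\<close>, each of the two remainder terms is at most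
      \<open>\<epsilon> / 2\<close>.\<close>
    define \<epsilon>3 where "\<epsilon>3 = \<epsilon> / (2 * (?K * norm u ^ 3 + 1))"
    define \<epsilon>4 where "\<epsilon>4 = \<epsilon> / (2 * ((norm u)\<^sup>2 + 1))"
    have den: "0 < ?K * norm u ^ 3 + 1" "0 < (norm u)\<^sup>2 + 1"
      using C1 by (auto intro!: add_nonneg_pos)
    have half: "\<epsilon> / (2 * q) * q = \<epsilon> / 2" if "0 < q" for q :: real using that by simp
    have \<epsilon>34: "0 < \<epsilon>3" "0 < \<epsilon>4" using \<epsilon> den by (auto simp: \<epsilon>3_def \<epsilon>4_def intro!: divide_pos_pos)
    define A3 where "A3 n = {\<omega> \<in> space M. ennreal (\<epsilon>3 * sqrt (brate a (\<tau> n))) \<le> X3 (\<tau> n) \<omega>}" for n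
    define A4 where "A4 n = {\<omega> \<in> space M. ennreal (\<epsilon>4 * brate a (\<tau> n) powr \<beta>1) \<le> X4 (\<tau> n) \<omega>}" for n
    have [measurable]: "A3 n \<in> sets M" "A4 n \<in> sets M" for n
      unfolding A3_def A4_def using X3_meas[OF T] X4_meas[OF T] by measurable
    have "(\<lambda>n. measure M (A3 n)) \<longlonglongrightarrow> 0" unfolding A3_def
    proof (rule tendsto_measure_of_cond_moments[OF X3_meas[OF T] M34(1) X3_fin[OF \<tau>] \<Psi>m \<Psi>lim])
      show "filterlim (\<lambda>n. \<epsilon>3 * sqrt (brate a (\<tau> n))) at_top sequentially"
        using \<epsilon>34 by (intro filterlim_tendsto_pos_mult_at_top[OF tendsto_const] filterlim_compose[OF sqrt_at_top blim])
    qed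
    moreover have "(\<lambda>n. measure M (A4 n)) \<longlonglongrightarrow> 0" unfolding A4_def
    proof (rule tendsto_measure_of_cond_moments[OF X4_meas[OF T] M34(2) X4_fin[OF \<tau>] \<Psi>m \<Psi>lim])
      show "filterlim (\<lambda>n. \<epsilon>4 * brate a (\<tau> n) powr \<beta>1) at_top sequentially"
        using \<epsilon>34 par(4) by (intro filterlim_tendsto_pos_mult_at_top[OF tendsto_const] filterlim_powr_at_top[OF _ blim])
    qed
    ultimately have lim: "(\<lambda>n. measure M (A3 n) + measure M (A4 n)) \<longlonglongrightarrow> 0"
      using tendsto_add by fastforce
    have "(\<lambda>n. norm (a (\<tau> n)) * norm u) \<longlonglongrightarrow> 0 * norm u" by (intro tendsto_intros a0)
    then have "\<forall>\<^sub>F n in sequentially. norm (a (\<tau> n)) * norm u < \<delta>"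
      using \<delta>(1) by (simp add: order_tendstoD)
    then have ev: "\<forall>\<^sub>F n in sequentially. measure M {\<omega> \<in> space M. \<epsilon> < \<bar>R (\<tau> n) u \<omega> - 0\<bar>} \<le> measure M (A3 n) + measure M (A4 n)"
    proof eventually_elim
      case (elim n)
      then have small: "norm (a (\<tau> n) *v u) < \<delta>"
        using norm_matrix_vector_mult_le[of "a (\<tau> n)" u] by linarith
      have U: "u \<in> UU \<Theta> a \<theta>s (\<tau> n)"
        using small \<delta>(2) by (auto simp: UU_def theta_dag_def dist_norm)
      let ?b = "brate a (\<tau> n)"
      have b0: "0 < ?b" using b(1)[OF T] .
      have "{\<omega> \<in> space M. \<epsilon> < \<bar>R (\<tau> n) u \<omega> - 0\<bar>} \<subseteq> A3 n \<union> A4 n"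
      proof (rule ccontr)
        assume "\<not> ?thesis"
        then obtain \<omega> where \<omega>: "\<omega> \<in> space M" "\<epsilon> < \<bar>R (\<tau> n) u \<omega>\<bar>" "\<omega> \<notin> A3 n" "\<omega> \<notin> A4 n" by auto
        let ?x = "\<epsilon>3 * sqrt ?b" and ?g = "norm (GammaT H a \<theta>s (\<tau> n) \<omega> - \<Gamma> \<omega>)"
        have x: "inverse ?b * norm (D3 (H (\<tau> n) \<omega>) \<theta>) \<le> ?x" if "\<theta> \<in> \<Theta>" for \<theta>
          using X3_le[OF T _ that] \<omega>(1,3) \<epsilon>34 b0 by (simp add: A3_def not_le)
        have "?b powr \<beta>1 * ?g < ?b powr \<beta>1 * \<epsilon>4"
          using \<omega>(1,4) by (simp add: A4_def X4_def not_le ennreal_less_iff mult.commute)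
        then have "?g \<le> \<epsilon>4" using b0 by simp
        then have "?g / 2 * (norm u)\<^sup>2 \<le> \<epsilon>4 * ((norm u)\<^sup>2 + 1)"
          using \<epsilon>34 by (intro mult_mono) auto
        also have "\<dots> = \<epsilon> / 2" unfolding \<epsilon>4_def by (rule half[OF den(2)])
        finally have g: "?g / 2 * (norm u)\<^sup>2 \<le> \<epsilon> / 2" .
        have "?K * ?x * norm u ^ 3 / sqrt ?b = \<epsilon>3 * (?K * norm u ^ 3)" using b0 by simp
        also have "\<dots> \<le> \<epsilon>3 * (?K * norm u ^ 3 + 1)" using \<epsilon>34 by (intro mult_left_mono) auto
        also have "\<dots> = \<epsilon> / 2" unfolding \<epsilon>3_def by (rule half[OF den(1)])
        finally have "?K * ?x * norm u ^ 3 / sqrt ?b \<le> \<epsilon> / 2" .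
        moreover have "\<bar>R (\<tau> n) u \<omega>\<bar> \<le> ?g / 2 * (norm u)\<^sup>2 + ?K * ?x * norm u ^ 3 / sqrt ?b"
          using quadratic_remainder_bound[where a=a and H=H and \<omega>=\<omega> and \<theta>s=\<theta>s and u=u and x="?x" and G="\<Gamma> \<omega>",
              OF b0 b(3)[OF T] _ C3[OF T \<omega>(1)] \<delta>(2) small x] C1 U
          by (simp add: R_def)
        ultimately show False using \<omega>(2) g by linarith
      qed
      then have "measure M {\<omega> \<in> space M. \<epsilon> < \<bar>R (\<tau> n) u \<omega> - 0\<bar>} \<le> measure M (A3 n \<union> A4 n)"
        by (intro finite_measure_mono) auto
      also have "\<dots> \<le> measure M (A3 n) + measure M (A4 n)" by (intro measure_Un_le) auto
      finally show ?case .
    qed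
    show "(\<lambda>n. measure M {\<omega> \<in> space M. \<epsilon> < \<bar>R (\<tau> n) u \<omega> - 0\<bar>}) \<longlonglongrightarrow> 0"
      by (rule tendsto_sandwich[OF _ ev tendsto_const lim]) simp
  qed
  show ?thesis
    using tail R_meas R_eq R_lim by (intro conjI ballI impI exI[of _ R] allI) auto
qed

end
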